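(* Let $s \in \mathbb{N}_0 = \{0,1,2,\ldots\}$ and let $f \in V_s$. Let $Q_n^{\mathrm{G}}$ and $Q_n^{\mathrm{CC}}$ denote the $n$-point Gauss and Clenshaw-Curtis quadrature formulas, respectively, on $[-1,1]$ for the weight function $w \equiv 1$. Then, as $n \to \infty$, $$\int_{-1}^1 f(x)\,\mathrm{d}x - Q_n^{\mathrm{CC}}[f] = O(n^{-s-1}) \quad \text{and} \quad \int_{-1}^1 f(x)\,\mathrm{d}x - Q_n^{\mathrm{G}}[f] = O(n^{-s-1}).$$
   Context: $\operatorname{Var} g$ denotes the total variation of a function $g$ over $[-1,1]$. The function classes are $V_0 := \{ f : [-1,1] \to \mathbb{R} : \operatorname{Var} f < \infty \}$ and, for $s \in \{1,2,\ldots\}$, $V_s := \{ f : [-1,1] \to \mathbb{R} : f^{(s-1)} \text{ is absolutely continuous and } \operatorname{Var} f^{(s)} < \infty \}$. For $s \ge 1$, $f^{(s)}$ is understood as a function on $[-1,1]$ of finite total variation that agrees almost everywhere with the derivative of $f^{(s-1)}$. A quadrature formula with $n$ nodes is a functional $Q[f] = \sum_{j=1}^n a_j f(x_j)$ with nodes $-1 \le x_1 < \cdots < x_n \le 1$ and real weights $a_j$; it is interpolatory (for $w \equiv 1$) if $Q[p] = \int_{-1}^1 p(x)\,\mathrm{d}x$ for all polynomials $p$ of degree at most $n-1$. The $n$-point Gauss formula $Q_n^{\mathrm{G}}$ is the interpolatory formula whose nodes are the zeros of the Legendre polynomial of degree $n$. The $n$-point Clenshaw-Curtis formula $Q_n^{\mathrm{CC}}$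 ($n \ge 2$) is the interpolatory formula with nodes $\cos\left(\frac{(j-1)\pi}{n-1}\right)$, $j = 1,\ldots,n$. *)

theory Defs
  imports
    "HOL-Analysis.Analysis"
    "HOL-Library.Landau_Symbols"
    "HOL-Computational_Algebra.Polynomial"
begin

text \<open>
  Functions on \<open>[-1,1]\<close> are modelled as total functions on the reals; all notions below depend
  only on the values on \<open>[-1,1]\<close>.
\<close>

definition total_variation_on :: "real set \<Rightarrow> (real \<Rightarrow> real) \<Rightarrow> ennreal" where
  "total_variation_on I g =
     (SUP (N, t) \<in> {(N :: nat, t :: nat \<Rightarrow> real).
                       (\<forall>i\<le>N. t i \<in> I) \<and> (\<forall>i<N. t i \<le> t (Suc i))}.
        ennreal (\<Sum>i<N. \<bar>g (t (Suc i)) - g (t i)\<bar>))"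

definition absolutely_continuous_on :: "real set \<Rightarrow> (real \<Rightarrow> real) \<Rightarrow> bool" where
  "absolutely_continuous_on I g \<longleftrightarrow>
     (\<forall>\<epsilon>>0. \<exists>\<delta>>0. \<forall>(N :: nat) (a :: nat \<Rightarrow> real) (b :: nat \<Rightarrow> real).
        (\<forall>i<N. a i \<in> I \<and> b i \<in> I \<and> a i \<le> b i) \<longrightarrow>
        disjoint_family_on (\<lambda>i. {a i<..<b i}) {..<N} \<longrightarrow>
        (\<Sum>i<N. b i - a i) < \<delta> \<longrightarrow>
        (\<Sum>i<N. \<bar>g (b i) - g (a i)\<bar>) < \<epsilon>)"

text \<open>
  \<open>nth_deriv_on I k f g\<close>: \<open>f\<close> is \<open>k\<close> times differentiable on \<open>I\<close> (one-sidedly at end points)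
  with \<open>k\<close>-th derivative \<open>g\<close>.
\<close>

primrec nth_deriv_on ::
  "real set \<Rightarrow> nat \<Rightarrow> (real \<Rightarrow> real) \<Rightarrow> (real \<Rightarrow> real) \<Rightarrow> bool" where
  "nth_deriv_on I 0 f g \<longleftrightarrow> (\<forall>x\<in>I. g x = f x)"
| "nth_deriv_on I (Suc k) f g \<longleftrightarrow>
     (\<exists>h. nth_deriv_on I k f h \<and> (\<forall>x\<in>I. (h has_real_derivative g x) (at x within I)))"

text \<open>
  In the successor case, \<open>g\<close> is the classical derivative \<open>f\<^sup>(\<^sup>r\<^sup>)\<close> and \<open>h\<close> is the version of
  \<open>f\<^sup>(\<^sup>r\<^sup>+\<^sup>1\<^sup>)\<close> of finite variation, which is only determined almost everywhere.
\<close>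

fun V :: "nat \<Rightarrow> (real \<Rightarrow> real) set" where
  "V 0 = {f. total_variation_on {-1..1} f < \<infinity>}"
| "V (Suc r) =
     {f. \<exists>g h. nth_deriv_on {-1..1} r f g \<and>
               absolutely_continuous_on {-1..1} g \<and>
               (AE x in lebesgue_on {-1..1}.
                  (g has_real_derivative h x) (at x within {-1..1})) \<and>
               total_variation_on {-1..1} h < \<infinity>}"

definition quadrature :: "nat \<Rightarrow> (nat \<Rightarrow> real) \<Rightarrow> (nat \<Rightarrow> real) \<Rightarrow> (real \<Rightarrow> real) \<Rightarrow> real" where
  "quadrature n a x f = (\<Sum>j=1..n. a j * f (x j))"

definition quadrature_nodes :: "nat \<Rightarrow> (nat \<Rightarrow> real) \<Rightarrow> bool" where
  "quadrature_nodes n x \<longleftrightarrow> (\<forall>j\<in>{1..n}. x j \<in> {-1..1}) \<and> strict_mono_on {1..n} x"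

definition interpolatory :: "nat \<Rightarrow> ((real \<Rightarrow> real) \<Rightarrow> real) \<Rightarrow> bool" where
  "interpolatory n Q \<longleftrightarrow>
     (\<forall>p :: real poly. degree p < n \<longrightarrow> Q (poly p) = integral {-1..1} (poly p))"

text \<open>
  The interpolatory \<open>n\<close>-point formula with node set \<open>X\<close>; as a functional it exists and is unique
  whenever \<open>X\<close> consists of exactly \<open>n\<close> points of \<open>[-1,1]\<close>.
\<close>

definition interpolatory_formula :: "nat \<Rightarrow> real set \<Rightarrow> (real \<Rightarrow> real) \<Rightarrow> real" where
  "interpolatory_formula n X =
     (THE Q. interpolatory n Q \<and>
             (\<exists>a x. quadrature_nodes n x \<and> x ` {1..n} = X \<and> Q = quadrature n a x))"

text \<open>Rodrigues' formula for the Legendre polynomials.\<close>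

definition legendre_poly :: "nat \<Rightarrow> real poly" where
  "legendre_poly n = smult (1 / (2 ^ n * fact n)) ((pderiv ^^ n) ([:-1, 0, 1:] ^ n))"

definition gauss_quadrature :: "nat \<Rightarrow> (real \<Rightarrow> real) \<Rightarrow> real" where
  "gauss_quadrature n = interpolatory_formula n {x. poly (legendre_poly n) x = 0}"

definition clenshaw_curtis_quadrature :: "nat \<Rightarrow> (real \<Rightarrow> real) \<Rightarrow> real" where
  "clenshaw_curtis_quadrature n =
     interpolatory_formula n ((\<lambda>j. cos ((real j - 1) * pi / (real n - 1))) ` {1..n})"

end

theory Submission
  imports Defs
begin

text \<open>
  Up to a polynomial of degree at most \<open>s\<close>, \<open>f\<close> is the \<open>s\<close>-fold integral of a function of bounded
  variation, hence of a difference of two monotone functions, and a monotone function is a uniform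
  limit of positive combinations of indicators of up-sets. The \<open>s\<close>-fold integral of such an indicator
  is a truncated power \<open>(x - t)\<^sup>s\<^sub>+ / s!\<close>, so it is enough to bound the quadrature error of truncated
  powers by \<open>C / n\<^sup>s\<^sup>+\<^sup>1\<close>, uniformly in \<open>t\<close>.

  Both Gauss and Clenshaw-Curtis formulas have nonnegative weights. If \<open>q\<close> and \<open>M\<close> are polynomials on
  which the formula is exact and \<open>\<bar>g - q\<bar> \<le> M\<close>, then the error for \<open>g\<close> is at most \<open>2 \<integral> M\<close>.
  For the truncated power take \<open>q(x) = (x - t)\<^sup>s \<sigma>(x - t)\<close>, where \<open>\<sigma>\<close> is a polynomial smoothing of the
  Heaviside function whose tails decay like a high power of \<open>1 / (n \<bar>x - t\<bar>)\<close>; the polynomial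
  \<open>2 \<sigma> (1 - \<sigma>)\<close> dominates the distance of \<open>\<sigma>\<close> from the Heaviside function.
\<close>

section \<open>Absolute continuity, bounded variation and iterated integrals\<close>

text \<open>The superposition of truncated powers is kept discrete: at accuracy \<open>1/N\<close> a
  monotone function needs at most \<open>N\<close> times its increment many indicators, each with
  coefficient \<open>1/N\<close>, so a bound uniform in \<open>t\<close> survives the sum, and
  \<open>N\<close> tends to infinity while the formula stays fixed. The exponent
  \<open>s + 1\<close> is height times width: at distance \<open>1/m\<close> from \<open>t\<close>
  the truncated power has size \<open>m^-s\<close>, and the smoothing error essentially lives on an
  interval of length \<open>1/m\<close>. The obstacle is that errors must be majorised by
  polynomials, since positivity of the weights can be combined with exactness only there, and that
  the tails must beat the growth of \<open>(x - t)^(2 * s)\<close>. Hence a step built from a high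
  power of an explicit kernel. Exactness below degree \<open>n\<close> serves both families alike;
  what differs is the positivity of the weights: orthogonality gives it for Gauss, explicit cosine
  moments for Clenshaw-Curtis.\<close>

lemma absolutely_continuous_on_has_integral:
  fixes g h :: "real \<Rightarrow> real"
  assumes "a \<le> b" and ac: "absolutely_continuous_on {a..b} g" and neg: "negligible N"
    and der: "\<And>x. x \<in> {a..b} - N \<Longrightarrow> (g has_real_derivative h x) (at x within {a..b})"
  shows "(h has_integral (g b - g a)) {a..b}"
proof -
  \<comment> \<open>With integrand 0 on \<open>N\<close>, cells tagged in \<open>N\<close> drop out
    of the Riemann sum, and only the increments of \<open>g\<close> over them remain to be
    controlled.\<close>
  define h0 where "h0 = (\<lambda>x. if x \<in> N then 0 else h x)"
  have "(h0 has_integral (g b - g a)) {a..b}"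
    unfolding has_integral_real
  proof (intro allI impI)
    fix e :: real assume "e > 0"
    \<comment> \<open>Cells with good tags contribute at most \<open>e1 * (b - a)\<close>, hence at
      most \<open>e / 2\<close>; the summand 1 covers \<open>a = b\<close>.\<close>
    define e1 where "e1 = e / (2 * (b - a + 1))"
    have "e1 > 0" using \<open>e > 0\<close> \<open>a \<le> b\<close> by (simp add: e1_def)
    have "e/2 > 0" using \<open>e > 0\<close> by simp
    then obtain \<delta> where "\<delta> > 0" and \<delta>: "\<And>(M::nat) u v. (\<forall>i<M. u i \<in> {a..b} \<and> v i \<in> {a..b} \<and> u i \<le> v i) \<Longrightarrow>
        disjoint_family_on (\<lambda>i. {u i<..<v i}) {..<M} \<Longrightarrow>
        (\<Sum>i<M. v i - u i) < \<delta> \<Longrightarrow> (\<Sum>i<M. \<bar>g (v i) - g (u i)\<bar>) < e/2"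
      using ac unfolding absolutely_continuous_on_def by meson
    obtain T where "open T" "N \<subseteq> T" "T \<in> lmeasurable" and T: "measure lebesgue T < \<delta>"
    proof -
      have N: "N \<in> lmeasurable" "measure lebesgue N = 0"
        using neg negligible_iff_measure by auto
      obtain T where T: "open T" "N \<subseteq> T" "(T - N) \<in> lmeasurable" "emeasure lebesgue (T - N) < ennreal \<delta>"
        using sets_lebesgue_outer_open[of N \<delta>] N \<open>\<delta> > 0\<close> by (metis fmeasurableD)
      have "T = (T - N) \<union> N" using T by auto
      then have "T \<in> lmeasurable" using N T by (metis fmeasurable.Un)
      moreover have "measure lebesgue T = measure lebesgue (T - N)"
        using neg \<open>T \<in> lmeasurable\<close> by (simp add: measure_Diff_null_set negligible_iff_null_sets)
      moreover have "measure lebesgue (T - N) < \<delta>"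
        using T(3,4) \<open>\<delta> > 0\<close> by (simp add: emeasure_eq_measure2 ennreal_less_iff)
      ultimately have "T \<in> lmeasurable" "measure lebesgue T < \<delta>" by auto
      note that[OF T(1,2) this]
      then show ?thesis .
    qed
    have "\<forall>x. \<exists>d. x \<in> {a..b} - N \<longrightarrow> d > 0 \<and>
        (\<forall>y\<in>{a..b}. \<bar>y - x\<bar> < d \<longrightarrow> \<bar>g y - g x - h x * (y - x)\<bar> \<le> e1 * \<bar>y - x\<bar>)"
    proof
      fix x
      show "\<exists>d. x \<in> {a..b} - N \<longrightarrow> d > 0 \<and>
        (\<forall>y\<in>{a..b}. \<bar>y - x\<bar> < d \<longrightarrow> \<bar>g y - g x - h x * (y - x)\<bar> \<le> e1 * \<bar>y - x\<bar>)"
        using der[of x] \<open>e1 > 0\<close>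
        unfolding has_field_derivative_def has_derivative_within_alt by fastforce
    qed
    then obtain d where d': "\<forall>x. x \<in> {a..b} - N \<longrightarrow> d x > 0 \<and>
        (\<forall>y\<in>{a..b}. \<bar>y - x\<bar> < d x \<longrightarrow> \<bar>g y - g x - h x * (y - x)\<bar> \<le> e1 * \<bar>y - x\<bar>)"
      unfolding choice_iff by (elim exE)
    then have d: "\<And>x. x \<in> {a..b} - N \<Longrightarrow> d x > 0"
      "\<And>x y. x \<in> {a..b} - N \<Longrightarrow> y \<in> {a..b} \<Longrightarrow> \<bar>y - x\<bar> < d x \<Longrightarrow> \<bar>g y - g x - h x * (y - x)\<bar> \<le> e1 * \<bar>y - x\<bar>"
      by blast+
    \<comment> \<open>Cells tagged in \<open>N\<close> are forced into \<open>T\<close>, so their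
      total length is below \<open>\<delta>\<close> and absolute continuity applies; any other cell
      is so short that \<open>g\<close> is linear on it up to \<open>e1\<close> times its
      length.\<close>
    define \<gamma> where "\<gamma> = (\<lambda>x. if x \<in> N then T else if x \<in> {a..b} then ball x (d x) else UNIV)"
    have "gauge \<gamma>"
      using \<open>open T\<close> \<open>N \<subseteq> T\<close> d by (auto simp: gauge_def \<gamma>_def)
    moreover have "norm ((\<Sum>(x,k)\<in>p. measure lborel k *\<^sub>R h0 x) - (g b - g a)) < e"
      if p: "p tagged_division_of {a..b}" "\<gamma> fine p" for p
    proof -
      note pD = tagged_division_ofD[OF p(1)]
      have fin: "finite p" using pD by blast
      define u where "u = (\<lambda>z::real \<times> real set. Inf (snd z))"
      define v where "v = (\<lambda>z::real \<times> real set. Sup (snd z))"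
      have K: "snd z = {u z..v z}" "u z \<le> v z" "fst z \<in> {u z..v z}" "u z \<in> {a..b}" "v z \<in> {a..b}" if "z \<in> p" for z
      proof -
        obtain x k where z: "z = (x,k)" by force
        have xk: "(x,k) \<in> p" using that z by simp
        from pD(4)[OF xk] obtain c d where k: "k = {c..d}" by auto
        have "x \<in> k" "k \<subseteq> {a..b}" using pD(2,3)[OF xk] by auto
        then show "snd z = {u z..v z}" "u z \<le> v z" "fst z \<in> {u z..v z}" "u z \<in> {a..b}" "v z \<in> {a..b}"
          using k z by (auto simp: u_def v_def)
      qed
      have fine: "snd z \<subseteq> \<gamma> (fst z)" if "z \<in> p" for z
        using p(2) that unfolding fine_def by (cases z) auto
      have tel: "(\<Sum>z\<in>p. g (v z) - g (u z)) = g b - g a"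
        using additive_tagged_division_1[OF \<open>a \<le> b\<close> p(1), of g] by (simp add: u_def v_def case_prod_unfold)
      have len: "(\<Sum>z\<in>p. v z - u z) = b - a"
        using additive_tagged_division_1[OF \<open>a \<le> b\<close> p(1), of "\<lambda>x. x"] by (simp add: u_def v_def case_prod_unfold)
      have cont: "(\<Sum>(x,k)\<in>p. measure lborel k *\<^sub>R h0 x) = (\<Sum>z\<in>p. (v z - u z) * h0 (fst z))"
        by (intro sum.cong) (use K in \<open>auto simp: case_prod_unfold\<close>)
      define q where "q = {z\<in>p. fst z \<in> N}"
      have finq: "finite q" using fin by (simp add: q_def)
      have good: "\<bar>(v z - u z) * h0 (fst z) - (g (v z) - g (u z))\<bar> \<le> e1 * (v z - u z)" if "z \<in> p - q" for z
      proof -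
        have z: "z \<in> p" "fst z \<in> {a..b} - N" "fst z \<notin> N" using that K[of z] by (auto simp: q_def)
        have "u z \<in> \<gamma> (fst z)" "v z \<in> \<gamma> (fst z)" using fine[OF z(1)] K[OF z(1)] by auto
        then have "\<bar>u z - fst z\<bar> < d (fst z)" "\<bar>v z - fst z\<bar> < d (fst z)"
          using z by (auto simp: \<gamma>_def dist_real_def)
        then have "\<bar>g (u z) - g (fst z) - h (fst z) * (u z - fst z)\<bar> \<le> e1 * \<bar>u z - fst z\<bar>"
            "\<bar>g (v z) - g (fst z) - h (fst z) * (v z - fst z)\<bar> \<le> e1 * \<bar>v z - fst z\<bar>"
          using d z K[OF z(1)] by blast+
        moreover have "e1 * \<bar>u z - fst z\<bar> + e1 * \<bar>v z - fst z\<bar> = e1 * (v z - u z)"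
          using K[OF z(1)] by (simp add: algebra_simps)
        moreover have "(v z - u z) * h0 (fst z) - (g (v z) - g (u z)) =
           (g (u z) - g (fst z) - h (fst z) * (u z - fst z)) - (g (v z) - g (fst z) - h (fst z) * (v z - fst z))"
          using z by (simp add: h0_def algebra_simps)
        ultimately show ?thesis by linarith
      qed
      have bad: "(\<Sum>z\<in>q. \<bar>g (v z) - g (u z)\<bar>) < e/2"
      proof -
        obtain f where f: "bij_betw f {..<card q} q"
          using ex_bij_betw_nat_finite[OF finq] by (auto simp: atLeast0LessThan)
        have fq: "f i \<in> p" "fst (f i) \<in> N" if "i < card q" for i
          using f that by (auto simp: bij_betw_def q_def)
        have disj: "disjoint_family_on (\<lambda>i. {u (f i)<..<v (f i)}) {..<card q}"
          unfolding disjoint_family_on_def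
        proof (intro ballI impI)
          fix i j assume ij: "i \<in> {..<card q}" "j \<in> {..<card q}" "i \<noteq> j"
          then have "f i \<noteq> f j" using f by (auto simp: bij_betw_def inj_on_def)
          then have "interior (snd (f i)) \<inter> interior (snd (f j)) = {}"
            using pD(5)[of "fst (f i)" "snd (f i)" "fst (f j)" "snd (f j)"] fq ij by auto
          then show "{u (f i)<..<v (f i)} \<inter> {u (f j)<..<v (f j)} = {}"
            using K(1)[OF fq(1), of i] K(1)[OF fq(1), of j] ij by simp
        qed
        have "(\<Sum>i<card q. v (f i) - u (f i)) = (\<Sum>i<card q. measure lebesgue {u (f i)<..<v (f i)})"
          by (intro sum.cong) (use K fq in auto)
        also have "\<dots> = measure lebesgue (\<Union>i<card q. {u (f i)<..<v (f i)})"
        proof (rule measure_UNION'[symmetric])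
          show "pairwise (\<lambda>i j. disjnt {u (f i)<..<v (f i)} {u (f j)<..<v (f j)}) {..<card q}"
            using disj by (auto simp: pairwise_def disjoint_family_on_def disjnt_def)
        qed auto
        also have "\<dots> \<le> measure lebesgue T"
        proof (rule measure_mono_fmeasurable)
          show "(\<Union>i<card q. {u (f i)<..<v (f i)}) \<subseteq> T"
          proof (rule UN_least)
            fix i assume "i \<in> {..<card q}"
            then have "snd (f i) \<subseteq> T" using fine[OF fq(1), of i] fq(2)[of i] by (simp add: \<gamma>_def)
            moreover have "snd (f i) = {u (f i)..v (f i)}" using K(1) fq(1) \<open>i \<in> {..<card q}\<close> by simp
            ultimately show "{u (f i)<..<v (f i)} \<subseteq> T" by auto
          qed
        qed (use \<open>T \<in> lmeasurable\<close> in auto)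
        finally have "(\<Sum>i<card q. v (f i) - u (f i)) < \<delta>" using T by linarith
        then have "(\<Sum>i<card q. \<bar>g (v (f i)) - g (u (f i))\<bar>) < e/2"
          by (intro \<delta> disj) (use K fq in auto)
        then show ?thesis
          using sum.reindex_bij_betw[OF f, of "\<lambda>z. \<bar>g (v z) - g (u z)\<bar>"] by simp
      qed
      have "\<bar>(\<Sum>z\<in>p. (v z - u z) * h0 (fst z)) - (\<Sum>z\<in>p. g (v z) - g (u z))\<bar>
          \<le> (\<Sum>z\<in>p. \<bar>(v z - u z) * h0 (fst z) - (g (v z) - g (u z))\<bar>)"
        by (simp flip: sum_subtractf)
      also have "\<dots> = (\<Sum>z\<in>p-q. \<bar>(v z - u z) * h0 (fst z) - (g (v z) - g (u z))\<bar>) + 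
                     (\<Sum>z\<in>q. \<bar>(v z - u z) * h0 (fst z) - (g (v z) - g (u z))\<bar>)"
        by (rule sum.subset_diff) (use fin in \<open>auto simp: q_def\<close>)
      also have "(\<Sum>z\<in>q. \<bar>(v z - u z) * h0 (fst z) - (g (v z) - g (u z))\<bar>) = (\<Sum>z\<in>q. \<bar>g (v z) - g (u z)\<bar>)"
        by (intro sum.cong) (auto simp: q_def h0_def)
      also have "(\<Sum>z\<in>p-q. \<bar>(v z - u z) * h0 (fst z) - (g (v z) - g (u z))\<bar>) \<le> (\<Sum>z\<in>p-q. e1 * (v z - u z))"
        by (intro sum_mono good)
      also have "\<dots> \<le> (\<Sum>z\<in>p. e1 * (v z - u z))"
        by (intro sum_mono2) (use fin K \<open>e1 > 0\<close> in auto)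
      also have "\<dots> = e1 * (b - a)" by (simp flip: sum_distrib_left add: len)
      also have "\<dots> \<le> e / 2" using \<open>e > 0\<close> \<open>a \<le> b\<close> by (simp add: e1_def field_simps)
      finally have "\<bar>(\<Sum>z\<in>p. (v z - u z) * h0 (fst z)) - (\<Sum>z\<in>p. g (v z) - g (u z))\<bar>
          \<le> e / 2 + (\<Sum>z\<in>q. \<bar>g (v z) - g (u z)\<bar>)" by simp
      then show ?thesis using bad unfolding cont tel real_norm_def by linarith
    qed
    ultimately show "\<exists>\<gamma>. gauge \<gamma> \<and> (\<forall>\<D>. \<D> tagged_division_of {a..b} \<and> \<gamma> fine \<D> \<longrightarrow>
        norm ((\<Sum>(x,k)\<in>\<D>. measure lborel k *\<^sub>R h0 x) - (g b - g a)) < e)"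
      by (intro exI[of _ \<gamma>]) simp
  qed
  then show ?thesis
    by (rule has_integral_spike[OF neg, rotated]) (auto simp: h0_def)
qed

section \<open>Total variation and the Jordan decomposition\<close>

lemma total_variation_on_mono: "I \<subseteq> J \<Longrightarrow> total_variation_on I g \<le> total_variation_on J g"
  unfolding total_variation_on_def by (intro SUP_subset_mono) auto

lemma total_variation_on_upper:
  assumes "\<forall>i\<le>N. t i \<in> I" "\<forall>i<N. t i \<le> t (Suc i)"
  shows "ennreal (\<Sum>i<N. \<bar>g (t (Suc i)) - g (t i)\<bar>) \<le> total_variation_on I g"
proof -
  have "(N, t) \<in> {(N, t). (\<forall>i\<le>N. t i \<in> I) \<and> (\<forall>i<N. t i \<le> t (Suc i))}" using assms by simp
  from SUP_upper[OF this, of "\<lambda>(N, t). ennreal (\<Sum>i<N. \<bar>g (t (Suc i)) - g (t i)\<bar>)"]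
  show ?thesis unfolding total_variation_on_def by simp
qed

text \<open>A partition of \<open>{a..x}\<close> extended by \<open>x\<close> and \<open>y\<close>
  is a partition of \<open>{a..y}\<close>. This half of additivity is what makes both the running
  variation and its difference with \<open>f\<close> nondecreasing.\<close>

lemma total_variation_on_increase:
  assumes fin: "total_variation_on {a..b} f < \<infinity>" and xy: "a \<le> x" "x \<le> y" "y \<le> b"
  shows "enn2real (total_variation_on {a..x} f) + \<bar>f y - f x\<bar> \<le> enn2real (total_variation_on {a..y} f)"
proof -
  have finy: "total_variation_on {a..y} f < \<infinity>"
    using total_variation_on_mono[of "{a..y}" "{a..b}" f] xy fin by (auto intro: le_less_trans)
  let ?v = "enn2real (total_variation_on {a..y} f)"
  have key: "(\<Sum>i<N. \<bar>f (t (Suc i)) - f (t i)\<bar>) + \<bar>f y - f x\<bar> \<le> ?v"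
    if t: "\<forall>i\<le>N. t i \<in> {a..x}" "\<forall>i<N. t i \<le> t (Suc i)" for N t
  proof -
    \<comment> \<open>Inserting \<open>x\<close> before \<open>y\<close> isolates the increment from
      \<open>x\<close> to \<open>y\<close>; the increment from \<open>t N\<close> to
      \<open>x\<close> is nonnegative and is dropped.\<close>
    define t' where "t' = (\<lambda>i. if i \<le> N then t i else if i = Suc N then x else y)"
    have "ennreal (\<Sum>i<Suc (Suc N). \<bar>f (t' (Suc i)) - f (t' i)\<bar>) \<le> total_variation_on {a..y} f"
    proof (rule total_variation_on_upper)
      show "\<forall>i\<le>Suc (Suc N). t' i \<in> {a..y}"
      proof (intro allI impI)
        fix i show "t' i \<in> {a..y}"
          using t(1)[rule_format, of i] xy by (auto simp: t'_def)
      qed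
      show "\<forall>i<Suc (Suc N). t' i \<le> t' (Suc i)"
      proof (intro allI impI)
        fix i show "t' i \<le> t' (Suc i)"
          using t(1)[rule_format, of i] t(2)[rule_format, of i] xy by (auto simp: t'_def)
      qed
    qed
    then have "(\<Sum>i<Suc (Suc N). \<bar>f (t' (Suc i)) - f (t' i)\<bar>) \<le> ?v"
      using finy by (subst (asm) ennreal_enn2real[symmetric]) (auto simp del: sum.lessThan_Suc ennreal_enn2real simp: ennreal_le_iff)
    moreover have "(\<Sum>i<N. \<bar>f (t' (Suc i)) - f (t' i)\<bar>) = (\<Sum>i<N. \<bar>f (t (Suc i)) - f (t i)\<bar>)"
      by (intro sum.cong) (auto simp: t'_def)
    ultimately show ?thesis by (simp add: t'_def)
  qed
  from key[of 0 "\<lambda>_. x"] xy have nn: "\<bar>f y - f x\<bar> \<le> ?v" by simp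
  have "total_variation_on {a..x} f \<le> ennreal (?v - \<bar>f y - f x\<bar>)"
    unfolding total_variation_on_def[of "{a..x}"]
  proof (rule SUP_least)
    fix p assume "p \<in> {(N :: nat, t). (\<forall>i\<le>N. t i \<in> {a..x}) \<and> (\<forall>i<N. t i \<le> t (Suc i))}"
    then obtain N t where p: "p = (N, t)" "\<forall>i\<le>N. t i \<in> {a..x}" "\<forall>i<N. t i \<le> t (Suc i)"
      by auto
    show "(case p of (N, t) \<Rightarrow> ennreal (\<Sum>i<N. \<bar>f (t (Suc i)) - f (t i)\<bar>)) \<le> ennreal (?v - \<bar>f y - f x\<bar>)"
      using key[OF p(2,3)] by (auto simp: p(1) intro!: ennreal_leI)
  qed
  then have "enn2real (total_variation_on {a..x} f) \<le> ?v - \<bar>f y - f x\<bar>"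
    using nn by (intro enn2real_leI) auto
  then show ?thesis by simp
qed

lemma finite_variation_Jordan:
  assumes "total_variation_on {a..b} f < \<infinity>"
  obtains u v where "mono_on {a..b} u" "mono_on {a..b} v" "\<And>x. f x = u x - v x"
proof
  let ?u = "\<lambda>x. enn2real (total_variation_on {a..x} f)"
  have *: "?u x + \<bar>f y - f x\<bar> \<le> ?u y" "?u x \<le> ?u y" if "a \<le> x" "x \<le> y" "y \<le> b" for x y
    using total_variation_on_increase[OF assms, of x y] that by linarith+
  show "mono_on {a..b} ?u"
    by (intro mono_onI *) auto
  show "mono_on {a..b} (\<lambda>x. ?u x - f x)"
  proof (intro mono_onI)
    fix x y assume "x \<in> {a..b}" "y \<in> {a..b}" "x \<le> y"
    then show "?u x - f x \<le> ?u y - f y" using *(1)[of x y] by simp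
  qed
qed simp

section \<open>Powers of the Volterra operator and Taylor expansion at -1\<close>

definition iint :: "nat \<Rightarrow> (real \<Rightarrow> real) \<Rightarrow> real \<Rightarrow> real" where
  "iint k = ((\<lambda>h x. integral {-1..x} h) ^^ k)"

lemma iint_0 [simp]: "iint 0 h = h"
  by (simp add: iint_def)

lemma iint_Suc: "iint (Suc k) h x = integral {-1..x} (iint k h)"
  by (simp add: iint_def)

lemma iint_Suc': "iint (Suc k) h = iint k (\<lambda>x. integral {-1..x} h)"
  unfolding iint_def funpow_Suc_right by simp

lemma iint_cong:
  assumes "\<And>x. x \<in> {-1..1} \<Longrightarrow> h x = h' x" "x \<in> {-1..1}"
  shows "iint k h x = iint k h' x"
  using assms(2)
proof (induction k arbitrary: x)
  case 0 then show ?case using assms(1) by simp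
next
  case (Suc k)
  then show ?case unfolding iint_Suc by (intro integral_cong Suc.IH) auto
qed

lemma iint_integrable:
  assumes "h integrable_on {-1..1}"
  shows "iint k h integrable_on {-1..1}"
proof (induction k)
  case 0 then show ?case using assms by simp
next
  case (Suc k)
  have "continuous_on {-1..1} (iint (Suc k) h)"
    unfolding iint_Suc using Suc by (rule indefinite_integral_continuous_1)
  then show ?case by (rule integrable_continuous_real)
qed

lemma iint_integrable_sub:
  assumes "h integrable_on {-1..1}" "x \<in> {-1..1}"
  shows "iint k h integrable_on {-1..x}"
  by (rule integrable_on_subinterval[OF iint_integrable[OF assms(1)]]) (use assms(2) in auto)

lemma iint_add:
  assumes "h integrable_on {-1..1}" "h' integrable_on {-1..1}" "x \<in> {-1..1}"
  shows "iint k (\<lambda>x. h x + h' x) x = iint k h x + iint k h' x"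
  using assms(3)
proof (induction k arbitrary: x)
  case (Suc k)
  have "iint (Suc k) (\<lambda>x. h x + h' x) x = integral {-1..x} (\<lambda>x. iint k h x + iint k h' x)"
    unfolding iint_Suc by (intro integral_cong Suc.IH) (use Suc.prems in auto)
  also have "\<dots> = iint (Suc k) h x + iint (Suc k) h' x"
    unfolding iint_Suc by (intro integral_add iint_integrable_sub assms Suc.prems)
  finally show ?case .
qed simp

lemma iint_cmul:
  assumes "x \<in> {-1..1}"
  shows "iint k (\<lambda>x. c * h x) x = c * iint k h x"
  using assms
proof (induction k arbitrary: x)
  case (Suc k)
  have "iint (Suc k) (\<lambda>x. c * h x) x = integral {-1..x} (\<lambda>x. c * iint k h x)"
    unfolding iint_Suc by (intro integral_cong Suc.IH) (use Suc.prems in auto)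
  then show ?case unfolding iint_Suc by simp
qed simp

lemma iint_diff:
  assumes "h integrable_on {-1..1}" "h' integrable_on {-1..1}" "x \<in> {-1..1}"
  shows "iint k (\<lambda>x. h x - h' x) x = iint k h x - iint k h' x"
  using iint_add[OF assms(1) integrable_cmul[OF assms(2), of "-1"] assms(3)]
    iint_cmul[OF assms(3), of k "-1" h'] by simp

lemma iint_sum:
  assumes "finite J" "\<And>j. j \<in> J \<Longrightarrow> h j integrable_on {-1..1}" "x \<in> {-1..1}"
  shows "iint k (\<lambda>x. \<Sum>j\<in>J. h j x) x = (\<Sum>j\<in>J. iint k (h j) x)"
  using assms(1,2)
proof (induction J)
  case empty
  show ?case using iint_cmul[OF assms(3), of k 0 "\<lambda>_. 0"] by simp
next
  case (insert j J)
  then show ?case by (simp add: iint_add[OF _ integrable_sum assms(3)])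
qed

lemma has_vector_derivative_power_div_fact:
  "((\<lambda>x. c / fact (Suc k) * (x - a) ^ Suc k) has_vector_derivative c / fact k * (x - a) ^ k) (at x within S)"
  for x :: real
proof -
  have "((\<lambda>x. (x - a) ^ Suc k) has_real_derivative of_nat (Suc k) * (1 * (x - a) ^ (Suc k - Suc 0))) (at x within S)"
    by (intro DERIV_power) (auto intro!: derivative_eq_intros)
  from DERIV_cmult[OF this, of "c / fact (Suc k)"]
  have "((\<lambda>x. c / fact (Suc k) * (x - a) ^ Suc k) has_real_derivative
      c / fact (Suc k) * (of_nat (Suc k) * (x - a) ^ k)) (at x within S)"
    by (simp only: diff_Suc_Suc diff_zero mult_1)
  moreover have "c / fact (Suc k) * (of_nat (Suc k) * (x - a) ^ k) = c / fact k * (x - a) ^ k"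
    unfolding fact_Suc by (simp del: of_nat_Suc)
  ultimately show ?thesis by (simp only: has_real_derivative_iff_has_vector_derivative)
qed

lemma iint_const:
  assumes "x \<in> {-1..1}"
  shows "iint k (\<lambda>_. c) x = c / fact k * (x + 1) ^ k"
  using assms
proof (induction k arbitrary: x)
  case (Suc k)
  have "((\<lambda>x. c / fact k * (x - (-1)) ^ k) has_integral
      (c / fact (Suc k) * (x - (-1)) ^ Suc k - c / fact (Suc k) * (-1 - (-1)) ^ Suc k)) {-1..x}"
    using Suc.prems
    by (intro fundamental_theorem_of_calculus has_vector_derivative_power_div_fact) auto
  then have "((\<lambda>x. iint k (\<lambda>_. c) x) has_integral (c / fact (Suc k) * (x + 1) ^ Suc k)) {-1..x}"
    using Suc.IH Suc.prems by (subst has_integral_cong[where g="\<lambda>x. c / fact k * (x + 1) ^ k"]) auto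
  then show ?case unfolding iint_Suc by (simp add: integral_unique)
qed simp

text \<open>Each integration costs at most a factor 2, the length of the interval.\<close>

lemma iint_bound:
  assumes "h integrable_on {-1..1}" "\<And>x. x \<in> {-1..1} \<Longrightarrow> \<bar>h x\<bar> \<le> B" "x \<in> {-1..1}"
  shows "\<bar>iint k h x\<bar> \<le> B * 2 ^ k"
  using assms(3)
proof (induction k arbitrary: x)
  case (Suc k)
  have "0 \<le> B" using assms(2)[of 0] by auto
  have "norm (integral (cbox (-1) x) (iint k h)) \<le> B * 2 ^ k * measure lborel (cbox (-1) x)"
  proof (rule integrable_bound)
    show "norm (iint k h y) \<le> B * 2 ^ k" if "y \<in> cbox (-1) x" for y
      using Suc.IH[of y] that Suc.prems by simp
  qed (use iint_integrable_sub[OF assms(1), of x k] \<open>0 \<le> B\<close> Suc.prems in auto)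
  also have "\<dots> \<le> B * 2 ^ k * 2" using Suc.prems \<open>0 \<le> B\<close> by (intro mult_left_mono) auto
  finally show ?case by (simp add: iint_Suc mult_ac)
qed (use assms in simp)

lemma degree_power_linear_le: "degree (smult c ([:a, 1::real:] ^ k)) \<le> k"
  by (metis degree_linear_power degree_smult_le)

text \<open>Taylor expansion at -1 with the remainder left as an iterated integral: the integration
  constant \<open>h (-1)\<close> of each step, integrated \<open>r\<close> times, becomes a multiple
  of \<open>(x + 1)^r\<close>.\<close>

lemma nth_deriv_on_iint:
  assumes "nth_deriv_on {-1..1} r f g" "g integrable_on {-1..1}"
  shows "\<exists>p. degree p \<le> r \<and> (\<forall>x\<in>{-1..1}. f x = poly p x + iint r g x)"
  using assms
proof (induction r arbitrary: g)
  case 0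
  then show ?case by (intro exI[of _ 0]) auto
next
  case (Suc r)
  then obtain h where h: "nth_deriv_on {-1..1} r f h"
    and d: "\<And>x. x \<in> {-1..1} \<Longrightarrow> (h has_real_derivative g x) (at x within {-1..1})" by auto
  have "continuous_on {-1..1} h"
    by (auto simp: continuous_on_eq_continuous_within intro: DERIV_continuous[OF d])
  then have "h integrable_on {-1..1}" by (rule integrable_continuous_real)
  with Suc.IH[OF h] obtain p where p: "degree p \<le> r" "\<And>x. x \<in> {-1..1} \<Longrightarrow> f x = poly p x + iint r h x"
    by auto
  have hx: "h x = h (-1) + integral {-1..x} g" if "x \<in> {-1..1}" for x
  proof -
    have "(g has_integral (h x - h (-1))) {-1..x}"
    proof (intro fundamental_theorem_of_calculus)
      fix y assume "y \<in> {-1..x}"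
      then have "(h has_vector_derivative g y) (at y within {-1..1})"
        using d that by (simp add: has_real_derivative_iff_has_vector_derivative)
      then show "(h has_vector_derivative g y) (at y within {-1..x})"
        by (rule has_vector_derivative_within_subset) (use that in auto)
    qed (use that in auto)
    then show ?thesis by (simp add: integral_unique)
  qed
  let ?p = "p + smult (h (-1) / fact r) ([:1, 1:] ^ r)"
  have "f x = poly ?p x + iint (Suc r) g x" if x: "x \<in> {-1..1}" for x
  proof -
    have "iint r h x = iint r (\<lambda>x. h (-1) + integral {-1..x} g) x"
      by (rule iint_cong[OF hx x])
    also have "\<dots> = iint r (\<lambda>_. h (-1)) x + iint r (\<lambda>x. integral {-1..x} g) x"
      by (intro iint_add x integrable_continuous_real indefinite_integral_continuous_1 Suc.prems) auto
    finally show ?thesis using p(2)[OF x] x by (simp add: iint_const iint_Suc' add_ac)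
  qed
  moreover have "degree ?p \<le> Suc r"
    using p(1) degree_power_linear_le[of "h (-1) / fact r" 1 r] by (intro degree_add_le) auto
  ultimately show ?case by blast
qed

text \<open>\<open>U\<close> is a half-line cut off at 1, with or without its left end
  \<open>Inf U\<close>. Integration does not see that point, and for positive \<open>s\<close> the
  power vanishes there; for \<open>s = 0\<close> the power is 1 and the indicator itself
  decides.\<close>

lemma iint_indicator_upset:
  assumes U: "U \<subseteq> {-1..1}" "U \<noteq> {}" "\<And>x y. x \<in> U \<Longrightarrow> x \<le> y \<Longrightarrow> y \<le> 1 \<Longrightarrow> y \<in> U"
    and x: "x \<in> {-1..1}"
  shows "iint s (indicat_real U) x = (x - Inf U) ^ s / fact s * indicat_real U x"
  using x
proof (induction s arbitrary: x)
  case (Suc s)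
  let ?t = "Inf U"
  have bdd: "bdd_below U" using U(1) by (meson bdd_below_Icc bdd_below_mono)
  have t: "?t \<in> {-1..1}"
  proof -
    obtain u where "u \<in> U" using U(2) by blast
    then have "?t \<le> 1" using cInf_lower[OF _ bdd, of u] U(1) by fastforce
    moreover have "-1 \<le> ?t" using U by (intro cInf_greatest) auto
    ultimately show ?thesis by simp
  qed
  have lt: "y \<notin> U" if "y < ?t" for y using that cInf_lower[OF _ bdd] by (meson not_le)
  have gt: "y \<in> U" if "?t < y" "y \<le> 1" for y
    using cInf_lessD[OF U(2) that(1)] U(3) that(2) less_imp_le by blast
  have IH: "integral {-1..x} (iint s (indicat_real U)) =
      integral {-1..x} (\<lambda>y. (y - ?t) ^ s / fact s * indicat_real U y)"
    by (intro integral_cong Suc.IH) (use Suc.prems in auto)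
  show ?case
  proof (cases "x \<le> ?t")
    case True
    have "((\<lambda>y. (y - ?t) ^ s / fact s * indicat_real U y) has_integral 0) {-1..x}"
      by (rule has_integral_spike_finite[of "{?t}" _ _ "\<lambda>_. 0"]) (use lt True in auto)
    moreover have "(x - ?t) ^ Suc s / fact (Suc s) * indicat_real U x = 0"
      using lt[of x] True by (cases "x = ?t") auto
    ultimately show ?thesis by (simp only: iint_Suc IH integral_unique)
  next
    case False
    have "((\<lambda>y. 1 / fact s * (y - ?t) ^ s) has_integral
      (1 / fact (Suc s) * (x - ?t) ^ Suc s - 1 / fact (Suc s) * (?t - ?t) ^ Suc s)) {?t..x}"
      using False
      by (intro fundamental_theorem_of_calculus has_vector_derivative_power_div_fact) auto
    moreover have "1 / fact (Suc s) * (x - ?t) ^ Suc s - 1 / fact (Suc s) * (?t - ?t) ^ Suc s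
        = (x - ?t) ^ Suc s / fact (Suc s)" by simp
    ultimately have "((\<lambda>y. 1 / fact s * (y - ?t) ^ s) has_integral
      ((x - ?t) ^ Suc s / fact (Suc s))) {?t..x}" by (simp only:)
    then have 1: "((\<lambda>y. (y - ?t) ^ s / fact s * indicat_real U y) has_integral
      ((x - ?t) ^ Suc s / fact (Suc s))) {?t..x}"
    proof (rule has_integral_spike_finite[of "{?t}", rotated 2])
      fix y assume "y \<in> {?t..x} - {?t}"
      then have "y \<in> U" using Suc.prems by (intro gt) auto
      then show "(y - ?t) ^ s / fact s * indicat_real U y = 1 / fact s * (y - ?t) ^ s" by simp
    qed simp
    have 2: "((\<lambda>y. (y - ?t) ^ s / fact s * indicat_real U y) has_integral 0) {-1..?t}"
      by (rule has_integral_spike_finite[of "{?t}" _ _ "\<lambda>_. 0"]) (use lt in auto)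
    have "((\<lambda>y. (y - ?t) ^ s / fact s * indicat_real U y) has_integral
        (0 + (x - ?t) ^ Suc s / fact (Suc s))) {-1..x}"
      by (rule has_integral_combine[OF _ _ 2 1]) (use t False in auto)
    moreover have "indicat_real U x = 1" using gt[of x] False Suc.prems by auto
    ultimately show ?thesis by (simp only: iint_Suc IH integral_unique)
  qed
qed simp

text \<open>Layer-cake decomposition: rounding \<open>N * (h - h (-1))\<close> down to an integer
  changes \<open>h\<close> by at most \<open>1 / N\<close>, and that integer counts the levels
  reached. Superlevel sets of a monotone function are up-sets. The bound on \<open>J\<close> keeps
  the total coefficient \<open>J / N\<close> below the increment of \<open>h\<close>, whatever
  \<open>N\<close> is.\<close>

lemma mono_on_approx_upsets:
  fixes h :: "real \<Rightarrow> real" and N :: nat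
  assumes "mono_on {-1..1} h" "N > 0"
  obtains J and U :: "nat \<Rightarrow> real set" where "real J \<le> real N * (h 1 - h (-1))"
    "\<And>i. U i \<subseteq> {-1..1}" "\<And>i x y. x \<in> U i \<Longrightarrow> x \<le> y \<Longrightarrow> y \<le> 1 \<Longrightarrow> y \<in> U i"
    "\<And>x. x \<in> {-1..1} \<Longrightarrow> \<bar>h x - (h (-1) + (\<Sum>i<J. indicat_real (U i) x) / N)\<bar> \<le> 1 / N"
proof
  define w where "w = (\<lambda>x. real N * (h x - h (-1)))"
  have wmono: "w x \<le> w y" if "x \<in> {-1..1}" "y \<in> {-1..1}" "x \<le> y" for x y
    using that assms by (auto simp: w_def mono_on_def)
  define J where "J = nat \<lfloor>w 1\<rfloor>"
  \<comment> \<open>Levels start at 1; level 0 is the constant \<open>h (-1)\<close>.\<close>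
  define U where "U = (\<lambda>i::nat. {x\<in>{-1..1}. real (Suc i) \<le> w x})"
  have w0: "0 \<le> w x" if "x \<in> {-1..1}" for x using wmono[of "-1" x] that by (simp add: w_def)
  show "real J \<le> real N * (h 1 - h (-1))"
    using w0[of 1] by (simp add: J_def w_def)
  show "U i \<subseteq> {-1..1}" for i by (auto simp: U_def)
  show "y \<in> U i" if "x \<in> U i" "x \<le> y" "y \<le> 1" for i x y
    using that wmono[of x y] by (auto simp: U_def)
  show "\<bar>h x - (h (-1) + (\<Sum>i<J. indicat_real (U i) x) / N)\<bar> \<le> 1 / N" if x: "x \<in> {-1..1}" for x
  proof -
    have "(\<Sum>i<J. indicat_real (U i) x) = (\<Sum>i<J. if x \<in> U i then 1 else 0)"
      by (intro sum.cong) auto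
    also have "\<dots> = real (card {i\<in>{..<J}. x \<in> U i})"
      by (subst sum.inter_filter[symmetric]) auto
    also have "{i\<in>{..<J}. x \<in> U i} = {..<nat \<lfloor>w x\<rfloor>}"
    proof -
      have "nat \<lfloor>w x\<rfloor> \<le> J" using wmono[of x 1] x unfolding J_def by (intro nat_mono floor_mono) auto
      moreover have "real (Suc i) \<le> w x \<longleftrightarrow> i < nat \<lfloor>w x\<rfloor>" for i
        by (simp add: zless_nat_eq_int_zless less_floor_iff add.commute)
      ultimately show ?thesis using x unfolding U_def by (intro set_eqI) (simp del: of_nat_Suc, linarith)
    qed
    finally have "(\<Sum>i<J. indicat_real (U i) x) = of_int \<lfloor>w x\<rfloor>" using w0[OF x] by simp
    moreover have "\<bar>w x - of_int \<lfloor>w x\<rfloor>\<bar> \<le> 1" by linarith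
    moreover have "h x - (h (-1) + of_int \<lfloor>w x\<rfloor> / N) = (w x - of_int \<lfloor>w x\<rfloor>) / N"
      using \<open>N > 0\<close> by (simp add: w_def field_simps)
    ultimately show ?thesis using \<open>N > 0\<close> by (simp add: divide_right_mono)
  qed
qed

section \<open>Localized polynomial approximation of truncated powers\<close>

text \<open>The cosine is at least \<open>1 / 2\<close> up to \<open>pi / 3\<close>, which exceeds
  1.\<close>

lemma sin_ge_half:
  assumes "0 \<le> x" "x \<le> (1::real)"
  shows "x / 2 \<le> sin x"
proof -
  have "sin 0 - 0 / 2 \<le> sin x - x / 2"
  proof (rule DERIV_nonneg_imp_nondecreasing[OF assms(1)])
    fix y assume y: "0 \<le> y" "y \<le> x"
    have "cos (pi / 3) \<le> cos y" using y assms pi_gt3 by (intro cos_monotone_0_pi_le) auto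
    then show "\<exists>d. ((\<lambda>x. sin x - x / 2) has_real_derivative d) (at y) \<and> 0 \<le> d"
      by (intro exI[of _ "cos y - 1/2"]) (auto intro!: derivative_eq_intros simp: cos_60)
  qed
  then show ?thesis by simp
qed

text \<open>The Dirichlet kernel \<open>sin ((2 * k + 1) * t) / sin t\<close> as a polynomial in
  \<open>y = sin t\<close>; up to sign it is the Chebyshev polynomial of degree
  \<open>2 * k + 1\<close> divided by \<open>y\<close>. The recursion is the sum formula for sines
  with \<open>2 * cos (2 * t) = 2 - 4 * y^2\<close>.\<close>

fun sin_poly :: "nat \<Rightarrow> real poly" where
  "sin_poly 0 = 1"
| "sin_poly (Suc 0) = [:3, 0, -4:]"
| "sin_poly (Suc (Suc k)) = [:2, 0, -4:] * sin_poly (Suc k) - sin_poly k"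

lemma sin_poly_sin: "sin t * poly (sin_poly k) (sin t) = sin (real (2 * k + 1) * t)"
proof (induction k rule: sin_poly.induct)
  case 2
  have "sin (3 * t) = sin (2 * t + t)" by (simp add: algebra_simps)
  also have "\<dots> = sin t * (2 * (1 - (sin t)\<^sup>2) + (1 - 2 * (sin t)\<^sup>2))"
    unfolding sin_add sin_double cos_double_sin cos_squared_eq[symmetric] by (simp add: power2_eq_square algebra_simps)
  finally show ?case by (simp add: power2_eq_square algebra_simps)
next
  case (3 k)
  let ?x = "real (2 * Suc k + 1) * t"
  have "sin (real (2 * Suc (Suc k) + 1) * t) + sin (real (2 * k + 1) * t) = sin (?x + 2 * t) + sin (?x - 2 * t)"
    by (simp add: algebra_simps)
  also have "\<dots> = 2 * cos (2 * t) * sin ?x"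
    unfolding sin_add sin_diff by simp
  also have "\<dots> = (2 - 4 * (sin t)\<^sup>2) * (sin t * poly (sin_poly (Suc k)) (sin t))"
    unfolding 3 cos_double_sin by (simp add: algebra_simps)
  also have "\<dots> = sin t * poly (sin_poly (Suc (Suc k))) (sin t) + sin t * poly (sin_poly k) (sin t)"
    by (simp add: algebra_simps power2_eq_square)
  finally show ?case unfolding 3 by simp
qed simp

lemma degree_sin_poly: "degree (sin_poly k) \<le> 2 * k"
proof (induction k rule: sin_poly.induct)
  case (3 k)
  have "degree ([:2, 0, -4:] * sin_poly (Suc k)) \<le> 2 + 2 * Suc k"
    using degree_mult_le[of "[:2, 0, -4:]" "sin_poly (Suc k)"] 3 by simp
  then show ?case using 3 by (auto intro!: degree_diff_le)
qed auto

lemma sin_poly_even: "poly (sin_poly k) (- x) = poly (sin_poly k) x"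
  by (induction k rule: sin_poly.induct) auto

lemma sin_poly_le:
  assumes "y \<in> {-1..1}"
  shows "\<bar>y * poly (sin_poly k) y\<bar> \<le> 1"
  using sin_poly_sin[of "arcsin y" k] assms abs_sin_le_one by simp

text \<open>With \<open>m = 2 * k + 1\<close> and \<open>y = sin t\<close>, the bound on
  \<open>y\<close> gives \<open>m * t \<le> 1\<close>, so
  \<open>y * poly (sin_poly k) y = sin (m * t)\<close> is at least \<open>m * t / 2\<close>, hence
  at least \<open>m * y / 2\<close>; then divide by \<open>y\<close>.\<close>

lemma sin_poly_ge:
  assumes "0 < y" "y \<le> 1 / (2 * real (2 * k + 1))"
  shows "real (2 * k + 1) / 2 \<le> poly (sin_poly k) y"
proof -
  define m where "m = real (2 * k + 1)"
  have m: "m \<ge> 1" by (simp add: m_def)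
  have "y \<le> 1 / (2 * m)" using assms by (simp add: m_def)
  also have "\<dots> \<le> sin (1 / m)" using sin_ge_half[of "1 / m"] m by simp
  finally have y: "y \<le> sin (1 / m)" .
  then have y1: "y \<le> 1" using sin_le_one order_trans by blast
  define t where "t = arcsin y"
  have sint: "sin t = y" using assms y1 by (simp add: t_def)
  have t0: "0 \<le> t" using assms y1 by (simp add: t_def arcsin_nonneg)
  have "1 / m \<le> 1" using m by simp
  then have "1 / m \<le> pi / 2" using pi_gt3 by linarith
  moreover have "- (pi / 2) \<le> 1 / m" using m pi_gt_zero by (smt (verit) divide_nonneg_nonneg)
  ultimately have "t \<le> 1 / m"
    using arcsin_le_arcsin[OF _ y] assms sin_le_one[of "1 / m"] by (simp add: t_def arcsin_sin)
  then have "m * t \<le> 1" using m by (simp add: field_simps)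
  then have "m * t / 2 \<le> sin (m * t)" using t0 m by (intro sin_ge_half) auto
  moreover have "y \<le> t" using sin_x_le_x[OF t0] sint by simp
  then have "m * y / 2 \<le> m * t / 2" using m by simp
  ultimately have "m * y / 2 \<le> sin (m * t)" by linarith
  also have "sin (m * t) = y * poly (sin_poly k) y"
    using sin_poly_sin[of t k] sint by (simp only: m_def)
  finally have "y * (m / 2) \<le> y * poly (sin_poly k) y" by (simp add: mult.commute)
  then show ?thesis using assms(1) by (simp only: mult_le_cancel_left_pos m_def)
qed

lemma poly_antiderivative:
  fixes p :: "real poly"
  obtains q where "pderiv q = p" "poly q 0 = 0" "degree q \<le> Suc (degree p)"
proof
  define q where "q = (\<Sum>i\<le>degree p. monom (coeff p i / real (Suc i)) (Suc i))"
  have "pderiv q = (\<Sum>i\<le>degree p. monom (coeff p i) i)"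
    unfolding q_def higher_pderiv_sum[of 1, simplified] by (intro sum.cong) (auto simp: pderiv_monom simp del: of_nat_Suc)
  then show "pderiv q = p" by (simp add: poly_as_sum_of_monoms)
  show "poly q 0 = 0" by (simp add: q_def poly_sum poly_monom)
  show "degree q \<le> Suc (degree p)"
    unfolding q_def by (intro degree_sum_le) (auto intro: degree_monom_le[THEN order_trans])
qed

text \<open>
  The step is the normalized primitive of an even power of \<open>sin_poly k\<close>: as \<open>\<bar>y * sin_poly k y\<bar> \<le> 1\<close>
  while \<open>sin_poly k\<close> is of size \<open>2 k + 1\<close> near \<open>0\<close>, the mass of this kernel concentrates
  at distance \<open>1 / (2 k + 1)\<close> from the origin.
\<close>

lemma smooth_step_poly:
  assumes "K \<ge> 1"
  obtains p :: "real poly" where "degree p \<le> 4 * k * K + 1"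
    "\<And>y. y \<in> {-1..1} \<Longrightarrow> 0 \<le> poly p y \<and> poly p y \<le> 1"
    "\<And>y. y \<in> {0..1} \<Longrightarrow> 1 / 2 \<le> poly p y" "\<And>y. y \<in> {-1..0} \<Longrightarrow> poly p y \<le> 1 / 2"
    "\<And>y. y \<in> {-1..1} \<Longrightarrow> (real (2 * k + 1) * \<bar>y\<bar>) ^ (2 * K - 1) * (poly p y * (1 - poly p y)) \<le> 4 ^ K"
proof -
  define m where "m = real (2 * k + 1)"
  have m: "m \<ge> 1" by (simp add: m_def)
  define \<kappa> where "\<kappa> = sin_poly k ^ (2 * K)"
  obtain q where q: "pderiv q = \<kappa>" "poly q 0 = 0" "degree q \<le> Suc (degree \<kappa>)"
    using poly_antiderivative .
  have der: "(poly q has_real_derivative poly \<kappa> x) (at x)" for x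
    using poly_DERIV[of q x] by (simp add: q)
  have \<kappa>0: "0 \<le> poly \<kappa> x" for x
    by (simp add: \<kappa>_def)
  have mono: "poly q x \<le> poly q y" if "x \<le> y" for x y
    using that by (rule DERIV_nonneg_imp_nondecreasing) (use der \<kappa>0 in blast)
  have odd: "poly q (- x) = - poly q x" for x
  proof -
    have "poly q x + poly q (- x) = poly q 0 + poly q (- 0)"
    proof (rule DERIV_isconst_all[where f = "\<lambda>x. poly q x + poly q (- x)"])
      have "((\<lambda>x. poly q (- x)) has_real_derivative poly \<kappa> (- y) * - 1) (at y)" for y
        by (rule DERIV_chain2[OF der]) (auto intro!: derivative_eq_intros)
      moreover have "poly \<kappa> (- y) = poly \<kappa> y" for y by (simp add: \<kappa>_def sin_poly_even)
      ultimately show "\<forall>y. ((\<lambda>x. poly q x + poly q (- x)) has_real_derivative 0) (at y)"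
        using DERIV_add[OF der] by fastforce
    qed
    then show ?thesis using q(2) by simp
  qed
  define e where "e = 2 * K - 1"
  have e: "2 * K = Suc e" "e \<ge> 1" using assms by (auto simp: e_def)
  \<comment> \<open>The kernel is at most \<open>y^-(e + 1)\<close> because
    \<open>y * sin_poly k\<close> stays in \<open>[-1,1]\<close>. Adding \<open>y^-e\<close> to the
    primitive therefore gives a nonincreasing function on \<open>(0,1]\<close>, and comparison with
    the value at 1 bounds the tail.\<close>
  have tail: "poly q 1 - poly q y \<le> inverse y ^ e" if y: "0 < y" "y \<le> 1" for y
  proof -
    have "poly q y + inverse y ^ e \<ge> poly q 1 + inverse 1 ^ e"
    proof (rule DERIV_nonpos_imp_nonincreasing[OF y(2), where f = "\<lambda>y. poly q y + inverse y ^ e"])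
      fix x assume x: "y \<le> x" "x \<le> 1"
      then have x0: "0 < x" using y by simp
      have "((\<lambda>y. inverse y ^ e) has_real_derivative real e * ((- (inverse x ^ Suc (Suc 0))) * inverse x ^ (e - Suc 0))) (at x)"
        using x0 by (intro DERIV_power DERIV_inverse) auto
      moreover have "real e * ((- (inverse x ^ Suc (Suc 0))) * inverse x ^ (e - Suc 0)) = - real e * inverse x ^ Suc e"
      proof -
        have "inverse x ^ Suc e = inverse x ^ (Suc (Suc 0) + (e - Suc 0))" using e by simp
        also have "\<dots> = inverse x ^ Suc (Suc 0) * inverse x ^ (e - Suc 0)"
          by (simp only: power_add)
        finally have "inverse x ^ Suc e = inverse x ^ Suc (Suc 0) * inverse x ^ (e - Suc 0)" .
        then show ?thesis by (simp only: mult_minus_left mult_minus_right)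
      qed
      ultimately have d: "((\<lambda>y. poly q y + inverse y ^ e) has_real_derivative (poly \<kappa> x + - real e * inverse x ^ Suc e)) (at x)"
        using DERIV_add[OF der] by metis
      have "\<bar>x * poly (sin_poly k) x\<bar> \<le> 1" using x y by (intro sin_poly_le) auto
      then have "\<bar>x * poly (sin_poly k) x\<bar> ^ Suc e \<le> 1" by (intro power_le_one) auto
      then have "x ^ Suc e * poly \<kappa> x \<le> 1"
        unfolding \<kappa>_def e(1)[symmetric] by (simp add: power_mult_distrib power_even_abs del: power_Suc)
      then have "poly \<kappa> x \<le> inverse x ^ Suc e"
        using x0 by (simp add: field_simps power_inverse del: power_Suc)
      also have "\<dots> \<le> real e * inverse x ^ Suc e" using e(2) x0 by simp
      finally have "poly \<kappa> x + - real e * inverse x ^ Suc e \<le> 0" by (simp del: power_Suc)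
      with d show "\<exists>d. ((\<lambda>y. poly q y + inverse y ^ e) has_real_derivative d) (at x) \<and> d \<le> 0"
        by blast
    qed
    then show ?thesis by simp
  qed
  \<comment> \<open>Lower bound for the total mass \<open>2 * poly q 1\<close>: on
    \<open>[0, 1 / (2 * m)]\<close> the kernel is at least \<open>(m / 2)^(2 * K)\<close>, which is
    where \<open>4 ^ K\<close> comes from.\<close>
  have q1: "m ^ e / 4 ^ K \<le> 2 * poly q 1"
  proof -
    let ?a = "1 / (2 * m)"
    have "0 < ?a" using m by simp
    then obtain z where z: "0 < z" "z < ?a" "poly q ?a - poly q 0 = (?a - 0) * poly (pderiv q) z"
      using poly_MVT[of 0 ?a q] by blast
    have "m / 2 \<le> poly (sin_poly k) z" using sin_poly_ge[of z k] z by (simp add: m_def)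
    then have "(m / 2) ^ (2 * K) \<le> poly \<kappa> z"
      unfolding \<kappa>_def poly_power using m by (intro power_mono) auto
    then have "?a * (m / 2) ^ (2 * K) \<le> poly q ?a" using z m q by (simp add: mult_left_mono divide_right_mono)
    also have "\<dots> \<le> poly q 1" using m by (intro mono) (simp add: field_simps)
    finally have "?a * (m / 2) ^ (2 * K) \<le> poly q 1" .
    moreover have "(m / 2) ^ (2 * K) = m * m ^ e / 4 ^ K"
      unfolding power_divide by (simp add: e(1)) (simp add: e(1)[symmetric] power_mult flip: power_Suc)
    ultimately show ?thesis using m by simp
  qed
  have q1pos: "0 < poly q 1" using q1 m by (smt (verit) divide_pos_pos zero_less_power)
  \<comment> \<open>\<open>q\<close> is odd, so this affine rescaling sends the values at -1, 0 and
    1 to 0, \<open>1 / 2\<close> and 1, and \<open>p (- y) = 1 - p y\<close>.\<close>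
  define p where "p = smult (1/2) (1 + smult (1 / poly q 1) q)"
  have p: "poly p y = (1 + poly q y / poly q 1) / 2" for y by (simp add: p_def)
  have bnd: "0 \<le> poly p y \<and> poly p y \<le> 1" if "y \<in> {-1..1}" for y
  proof -
    have "- poly q 1 \<le> poly q y" "poly q y \<le> poly q 1"
      using mono[of "-1" y] mono[of y 1] odd[of 1] that by auto
    then have "-1 \<le> poly q y / poly q 1" "poly q y / poly q 1 \<le> 1" using q1pos by (auto simp: field_simps)
    then show ?thesis by (simp add: p)
  qed
  have tailp: "(m * y) ^ e * (1 - poly p y) \<le> 4 ^ K" if y: "0 \<le> y" "y \<le> 1" for y
  proof (cases "y = 0")
    case True then show ?thesis using e by (simp add: zero_power)
  next
    case False
    have "1 - poly p y = (poly q 1 - poly q y) / (2 * poly q 1)" using q1pos by (simp add: p field_simps)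
    also have "\<dots> \<le> inverse y ^ e / (m ^ e / 4 ^ K)"
      using tail[of y] False y q1 m by (intro frac_le) auto
    finally have "(m * y) ^ e * (1 - poly p y) \<le> (m * y) ^ e * (inverse y ^ e / (m ^ e / 4 ^ K))"
      using y m by (intro mult_left_mono) auto
    also have "\<dots> = 4 ^ K" using False m by (simp add: power_mult_distrib power_inverse)
    finally show ?thesis .
  qed
  have sym: "poly p (- y) = 1 - poly p y" for y using q1pos by (simp add: p odd field_simps)
  show ?thesis
  proof
    have "degree \<kappa> \<le> (2 * k) * (2 * K)"
      unfolding \<kappa>_def using degree_power_le[of "sin_poly k" "2 * K"] degree_sin_poly[of k]
      by (meson mult_le_mono1 order_trans)
    then have "degree q \<le> 4 * k * K + 1" using q(3) by simp
    then show "degree p \<le> 4 * k * K + 1"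
      unfolding p_def by (intro degree_smult_le[THEN order_trans] degree_add_le) auto
    show "1 / 2 \<le> poly p y" if "y \<in> {0..1}" for y
      using mono[of 0 y] that q1pos q(2) by (simp add: p)
    show "poly p y \<le> 1 / 2" if "y \<in> {-1..0}" for y
      using mono[of y 0] that q1pos q(2) by (simp add: p divide_nonpos_nonneg)
    show "(real (2 * k + 1) * \<bar>y\<bar>) ^ (2 * K - 1) * (poly p y * (1 - poly p y)) \<le> 4 ^ K"
      if y: "y \<in> {-1..1}" for y
    proof -
      have *: "(m * x) ^ e * (poly p x * (1 - poly p x)) \<le> 4 ^ K" if "0 \<le> x" "x \<le> 1" for x
      proof -
        have "poly p x * (1 - poly p x) \<le> 1 - poly p x"
          using bnd[of x] that by (intro mult_left_le_one_le) auto
        then have "(m * x) ^ e * (poly p x * (1 - poly p x)) \<le> (m * x) ^ e * (1 - poly p x)"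
          using m that by (intro mult_left_mono) auto
        with tailp[OF that] show ?thesis by linarith
      qed
      have "poly p \<bar>y\<bar> * (1 - poly p \<bar>y\<bar>) = poly p y * (1 - poly p y)"
        using sym[of y] by (auto simp: abs_if)
      then show ?thesis using *[of "\<bar>y\<bar>"] y by (auto simp: m_def e_def)
    qed
  qed (use bnd in auto)
qed

lemma degree_pcompose_linear_le: "degree (pcompose p [:a, b::real:]) \<le> degree p"
  using degree_pcompose_le[of p "[:a, b:]"] degree_pCons_le[of a "[:b:]"]
  by (metis (no_types) degree_pCons_0 le_trans mult.right_neutral mult_le_mono2 One_nat_def)

text \<open>The two inclusions leave open whether \<open>t\<close> belongs to \<open>U\<close>, so
  the estimate holds for either value at the jump. In the degree bound, \<open>D\<close> accounts
  for twice the degree of the smoothed step and the factor in front of it for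
  \<open>2 * s\<close>.\<close>

lemma truncated_power_poly_approx:
  obtains C :: real where "\<And>k t U. t \<in> {-1..1} \<Longrightarrow> {t<..1} \<subseteq> U \<Longrightarrow> U \<subseteq> {t..1} \<Longrightarrow>
    \<exists>q M. degree q \<le> 8 * (s + 2) * (k + 1) \<and> degree M \<le> 8 * (s + 2) * (k + 1) \<and>
      (\<forall>x\<in>{-1..1}. \<bar>(x - t) ^ s * indicat_real U x - poly q x\<bar> \<le> poly M x) \<and>
      integral {-1..1} (poly M) \<le> C / real (2 * k + 1) ^ (s + 1)"
proof
  \<comment> \<open>The tail order \<open>2 * K - 1 = 2 * s + 3\<close> has to absorb
    \<open>w^(2 * s)\<close> from the majorant and \<open>w^2\<close> for integrability.\<close>
  define K where "K = s + 2"
  define C0 :: real where "C0 = 8 * 4 ^ K * 2 ^ (2 * K - 1)"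
  fix k and t :: real and U assume t: "t \<in> {-1..1}" and U: "{t<..1} \<subseteq> U" "U \<subseteq> {t..1}"
  define m where "m = real (2 * k + 1)"
  have m: "m \<ge> 1" by (simp add: m_def)
  have "K \<ge> 1" by (simp add: K_def)
  obtain p where p: "degree p \<le> 4 * k * K + 1"
    "\<And>y. y \<in> {-1..1} \<Longrightarrow> 0 \<le> poly p y \<and> poly p y \<le> 1"
    "\<And>y. y \<in> {0..1} \<Longrightarrow> 1 / 2 \<le> poly p y" "\<And>y. y \<in> {-1..0} \<Longrightarrow> poly p y \<le> 1 / 2"
    "\<And>y. y \<in> {-1..1} \<Longrightarrow> (m * \<bar>y\<bar>) ^ (2 * K - 1) * (poly p y * (1 - poly p y)) \<le> 4 ^ K"
    using smooth_step_poly[OF \<open>K \<ge> 1\<close>, of k thesis] unfolding m_def by blast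
  \<comment> \<open>Halving keeps \<open>(x - t) / 2\<close> in \<open>[-1,1]\<close>, where
    \<open>p\<close> is controlled; the price is the factor \<open>2 ^ (2 * K - 1)\<close> in the
    tail bound.\<close>
  define \<sigma> where "\<sigma> = pcompose p [:- t / 2, 1 / 2:]"
  have \<sigma>: "poly \<sigma> x = poly p ((x - t) / 2)" for x by (simp add: \<sigma>_def poly_pcompose diff_divide_distrib)
  have deg\<sigma>: "degree \<sigma> \<le> 4 * k * K + 1"
    unfolding \<sigma>_def using degree_pcompose_linear_le p(1) order_trans by blast
  \<comment> \<open>For \<open>c\<close> in \<open>[0,1]\<close>, the larger of \<open>c\<close> and
    \<open>1 - c\<close> is at least \<open>1 / 2\<close>, so \<open>2 * c * (1 - c)\<close>
    dominates the smaller one, the distance from the step; unlike the minimum it is a polynomial in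
    \<open>c\<close>. At \<open>x = t\<close> both distances are covered.\<close>
  define D where "D = smult 2 (\<sigma> * (1 - \<sigma>))"
  define q where "q = [:- t, 1:] ^ s * \<sigma>"
  \<comment> \<open>The weights \<open>1 / m ^ s\<close> and \<open>m ^ s\<close> balance the two
    terms at \<open>\<bar>x - t\<bar> = 1 / m\<close>, the width of the step.\<close>
  define M where "M = smult (1 / 2) ([:1 / m ^ s:] + smult (m ^ s) ([:- t, 1:] ^ (2 * s))) * D"
  have polyM: "poly M x = 1 / 2 * (1 / m ^ s + m ^ s * (x - t) ^ (2 * s)) * poly D x" for x
    by (simp add: M_def)
  have lin: "degree ([:- t, 1:] ^ n) = n" for n by (rule degree_linear_power)
  have "degree D \<le> 8 * k * K + 2"
  proof -
    have "degree (1 - \<sigma>) \<le> 4 * k * K + 1" using deg\<sigma> by (intro degree_diff_le) auto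
    then have "degree (\<sigma> * (1 - \<sigma>)) \<le> (4 * k * K + 1) + (4 * k * K + 1)"
      using degree_mult_le[of \<sigma> "1 - \<sigma>"] deg\<sigma> by linarith
    then show ?thesis using degree_smult_le[of 2 "\<sigma> * (1 - \<sigma>)"] unfolding D_def by linarith
  qed
  moreover have "degree (smult (1 / 2) ([:1 / m ^ s:] + smult (m ^ s) ([:- t, 1:] ^ (2 * s)))) \<le> 2 * s"
    using lin by (intro degree_smult_le[THEN order_trans] degree_add_le) auto
  ultimately have "degree M \<le> 2 * s + (8 * k * K + 2)"
    using degree_mult_le[of "smult (1 / 2) ([:1 / m ^ s:] + smult (m ^ s) ([:- t, 1:] ^ (2 * s)))" D]
    unfolding M_def by linarith
  then have degM: "degree M \<le> 8 * (s + 2) * (k + 1)" by (simp add: K_def algebra_simps)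
  have "degree q \<le> s + (4 * k * K + 1)"
    using degree_mult_le[of "[:- t, 1:] ^ s" \<sigma>] lin[of s] deg\<sigma> unfolding q_def by linarith
  then have degq: "degree q \<le> 8 * (s + 2) * (k + 1)" by (simp add: K_def algebra_simps)
  have D0: "0 \<le> poly D x" and D1: "poly D x \<le> 1 / 2"
    and tail: "(m * \<bar>x - t\<bar>) ^ (2 * K - 1) * poly D x \<le> 2 * 4 ^ K * 2 ^ (2 * K - 1)"
    and step: "\<bar>indicat_real U x - poly \<sigma> x\<bar> \<le> poly D x" if x: "x \<in> {-1..1}" for x
  proof -
    let ?y = "(x - t) / 2"
    have y: "?y \<in> {-1..1}" using x t by auto
    define c where "c = poly p ?y"
    have D: "poly D x = 2 * (c * (1 - c))" by (simp add: D_def \<sigma> c_def)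
    have c: "0 \<le> c" "c \<le> 1" using p(2)[OF y] by (auto simp: c_def)
    then show "0 \<le> poly D x" by (simp add: D)
    have "0 \<le> (2 * c - 1)\<^sup>2" by simp
    then show "poly D x \<le> 1 / 2" unfolding D by (simp add: power2_eq_square algebra_simps)
    have "(m * \<bar>x - t\<bar>) ^ (2 * K - 1) = 2 ^ (2 * K - 1) * (m * \<bar>?y\<bar>) ^ (2 * K - 1)"
      by (simp flip: power_mult_distrib)
    then show "(m * \<bar>x - t\<bar>) ^ (2 * K - 1) * poly D x \<le> 2 * 4 ^ K * 2 ^ (2 * K - 1)"
      using mult_left_mono[OF p(5)[OF y], of "2 * 2 ^ (2 * K - 1)"] by (simp add: D c_def mult_ac)
    have up: "1 - c \<le> poly D x" if "x \<ge> t"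
    proof -
      have "1 / 2 \<le> c" using p(3)[of ?y] y that by (simp add: c_def)
      then have "1 * (1 - c) \<le> (2 * c) * (1 - c)" using c by (intro mult_right_mono) auto
      then show ?thesis by (simp add: D)
    qed
    have down: "c \<le> poly D x" if "x \<le> t"
    proof -
      have "c \<le> 1 / 2" using p(4)[of ?y] y that by (simp add: c_def)
      then have "c * 1 \<le> c * (2 * (1 - c))" using c by (intro mult_left_mono) auto
      then show ?thesis by (simp add: D algebra_simps)
    qed
    have "\<bar>indicat_real U x - c\<bar> \<le> poly D x"
    proof (cases "x \<in> U")
      case True then show ?thesis using U up c by auto
    next
      case False
      then have "x \<le> t" using U(1) x by force
      then show ?thesis using False down c by simp
    qed
    then show "\<bar>indicat_real U x - poly \<sigma> x\<bar> \<le> poly D x" by (simp add: \<sigma> c_def)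
  qed
  have approx: "\<bar>(x - t) ^ s * indicat_real U x - poly q x\<bar> \<le> poly M x" if x: "x \<in> {-1..1}" for x
  proof -
    have "(x - t) ^ s * indicat_real U x - poly q x = (x - t) ^ s * (indicat_real U x - poly \<sigma> x)"
      by (simp add: q_def algebra_simps)
    then have "\<bar>(x - t) ^ s * indicat_real U x - poly q x\<bar> = \<bar>x - t\<bar> ^ s * \<bar>indicat_real U x - poly \<sigma> x\<bar>"
      by (simp add: abs_mult power_abs)
    also have "\<dots> \<le> \<bar>x - t\<bar> ^ s * poly D x" using step[OF x] by (intro mult_left_mono) auto
    also have "\<dots> \<le> 1 / 2 * (1 / m ^ s + m ^ s * (x - t) ^ (2 * s)) * poly D x"
    proof (rule mult_right_mono[OF _ D0[OF x]])
      \<comment> \<open>AM-GM replaces \<open>\<bar>x - t\<bar> ^ s\<close>, which for odd \<open>s\<close> is not a polynomial.\<close>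
      have "0 \<le> (1 - m ^ s * \<bar>x - t\<bar> ^ s)\<^sup>2" by simp
      also have "\<dots> = 1 + m ^ s * m ^ s * (\<bar>x - t\<bar> ^ s)\<^sup>2 - 2 * m ^ s * \<bar>x - t\<bar> ^ s"
        by (simp add: power2_eq_square algebra_simps)
      also have "(\<bar>x - t\<bar> ^ s)\<^sup>2 = (x - t) ^ (2 * s)"
        by (simp add: power_abs[symmetric] mult.commute[of 2 s] power_mult del: power_abs)
      finally show "\<bar>x - t\<bar> ^ s \<le> 1 / 2 * (1 / m ^ s + m ^ s * (x - t) ^ (2 * s))"
        using m by (simp add: field_simps)
    qed
    finally show ?thesis by (simp add: polyM)
  qed
  \<comment> \<open>In the scaled distance \<open>w\<close> the majorant is
    \<open>1 / (2 * m ^ s)\<close> times \<open>(1 + w ^ (2 * s)) * D\<close>. For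
    \<open>w \<le> 1\<close> the bound \<open>1 / 2\<close> on \<open>D\<close> suffices, beyond
    that the tail bound is used. The comparison function has an arctangent as primitive, so its
    integral is at most a constant times \<open>pi / m\<close>.\<close>
  have Mle: "poly M x \<le> C0 / 2 / m ^ s * (1 / (1 + (m * (x - t))\<^sup>2))" if x: "x \<in> {-1..1}" for x
  proof -
    define w where "w = m * \<bar>x - t\<bar>"
    have w0: "0 \<le> w" using m by (simp add: w_def)
    have w2: "(m * (x - t))\<^sup>2 = w\<^sup>2" by (simp add: w_def power_mult_distrib)
    have "m ^ s * (x - t) ^ (2 * s) = w ^ (2 * s) / m ^ s"
    proof -
      have "w ^ (2 * s) = m ^ (2 * s) * (x - t) ^ (2 * s)"
        by (simp add: w_def power_mult_distrib power_even_abs)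
      moreover have "m ^ (2 * s) = m ^ s * m ^ s" by (simp add: mult_2 power_add)
      ultimately show ?thesis using m by simp
    qed
    then have M: "poly M x = 1 / 2 / m ^ s * ((1 + w ^ (2 * s)) * poly D x)"
      unfolding polyM by (simp add: add_divide_distrib[symmetric])
    have "(1 + w\<^sup>2) * ((1 + w ^ (2 * s)) * poly D x) \<le> C0"
    proof (cases "w \<le> 1")
      case True
      have "(1 + w\<^sup>2) * ((1 + w ^ (2 * s)) * poly D x) \<le> (1 + 1) * ((1 + 1) * (1 / 2))"
        using True w0 D1[OF x] D0[OF x] power_le_one[of w "2 * s"] power_le_one[of w 2]
        by (intro mult_mono add_mono) auto
      also have "\<dots> \<le> 8 * 1 * 1" by simp
      also have "\<dots> \<le> C0" unfolding C0_def by (intro mult_mono) auto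
      finally show ?thesis .
    next
      case False
      then have w1: "1 \<le> w" by simp
      have "(1 + w\<^sup>2) * ((1 + w ^ (2 * s)) * poly D x) \<le> (2 * w\<^sup>2) * ((2 * w ^ (2 * s)) * poly D x)"
        using one_le_power[OF w1, of 2] one_le_power[OF w1, of "2 * s"] D0[OF x]
        by (intro mult_mono) auto
      also have "\<dots> = 4 * (w ^ (2 + 2 * s) * poly D x)" by (simp only: power_add mult_ac)
      also have "\<dots> \<le> 4 * (w ^ (2 * K - 1) * poly D x)"
        using w1 D0[OF x] by (intro mult_left_mono mult_right_mono power_increasing) (auto simp: K_def)
      also have "\<dots> \<le> C0" using tail[OF x] unfolding C0_def w_def by linarith
      finally show ?thesis .
    qed
    then have "(1 + w ^ (2 * s)) * poly D x \<le> C0 / (1 + w\<^sup>2)"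
      by (simp add: pos_le_divide_eq add_pos_nonneg mult.commute)
    then have "1 / 2 / m ^ s * ((1 + w ^ (2 * s)) * poly D x) \<le> 1 / 2 / m ^ s * (C0 / (1 + w\<^sup>2))"
      using m by (intro mult_left_mono) auto
    then show ?thesis unfolding M w2 by simp
  qed
  have "integral {-1..1} (poly M) \<le> C0 / 2 / m ^ s * (pi / m)"
  proof -
    have I: "((\<lambda>x. 1 / (1 + (m * (x - t))\<^sup>2)) has_integral
        (arctan (m * (1 - t)) / m - arctan (m * (-1 - t)) / m)) {-1..1}"
    proof (rule fundamental_theorem_of_calculus)
      fix x :: real
      have "((\<lambda>x. arctan (m * (x - t)) / m) has_real_derivative
         (inverse (1 + (m * (x - t))\<^sup>2) * (m * 1)) / m) (at x within {-1..1})"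
        by (auto intro!: derivative_eq_intros)
      then show "((\<lambda>x. arctan (m * (x - t)) / m) has_vector_derivative
         1 / (1 + (m * (x - t))\<^sup>2)) (at x within {-1..1})"
        using m by (simp add: has_real_derivative_iff_has_vector_derivative inverse_eq_divide)
    qed simp
    have "integral {-1..1} (poly M) \<le> C0 / 2 / m ^ s * (arctan (m * (1 - t)) / m - arctan (m * (-1 - t)) / m)"
    proof (rule has_integral_le)
      show "(poly M has_integral integral {-1..1} (poly M)) {-1..1}"
        by (intro integrable_integral integrable_continuous_real continuous_intros)
      show "((\<lambda>x. C0 / 2 / m ^ s * (1 / (1 + (m * (x - t))\<^sup>2))) has_integral
         C0 / 2 / m ^ s * (arctan (m * (1 - t)) / m - arctan (m * (-1 - t)) / m)) {-1..1}"
        by (intro has_integral_mult_right I)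
    qed (use Mle in auto)
    also have "\<dots> \<le> C0 / 2 / m ^ s * (pi / m)"
    proof (rule mult_left_mono)
      have "arctan (m * (1 - t)) - arctan (m * (-1 - t)) \<le> pi"
        using arctan_ubound[of "m * (1 - t)"] arctan_lbound[of "m * (-1 - t)"] by linarith
      then show "arctan (m * (1 - t)) / m - arctan (m * (-1 - t)) / m \<le> pi / m"
        using m by (simp add: divide_right_mono flip: diff_divide_distrib)
      show "0 \<le> C0 / 2 / m ^ s" using m by (simp add: C0_def)
    qed
    finally show ?thesis .
  qed
  then have "integral {-1..1} (poly M) \<le> C0 * pi / 2 / m ^ (s + 1)"
    by (simp add: mult.commute mult.left_commute)
  then show "\<exists>q M. degree q \<le> 8 * (s + 2) * (k + 1) \<and> degree M \<le> 8 * (s + 2) * (k + 1) \<and>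
      (\<forall>x\<in>{-1..1}. \<bar>(x - t) ^ s * indicat_real U x - poly q x\<bar> \<le> poly M x) \<and>
      integral {-1..1} (poly M) \<le> 8 * 4 ^ (s + 2) * 2 ^ (2 * (s + 2) - 1) * pi / 2 / real (2 * k + 1) ^ (s + 1)"
    using degq degM approx unfolding m_def C0_def K_def by blast
qed

section \<open>Interpolatory formulas and Gauss weights\<close>

text \<open>The common ground of both families. Weights are attached to nodes instead of indices,
  since an interpolatory formula depends on its node set only; \<open>n_pos\<close> makes constants
  exact.\<close>

locale positive_quadrature =
  fixes n :: nat and X :: "real set" and w :: "real \<Rightarrow> real"
  assumes finite_nodes: "finite X" and nodes: "X \<subseteq> {-1..1}"
    and weight_nonneg: "\<And>y. y \<in> X \<Longrightarrow> 0 \<le> w y"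
    and exact: "\<And>p :: real poly. degree p < n \<Longrightarrow> (\<Sum>y\<in>X. w y * poly p y) = integral {-1..1} (poly p)"
    and n_pos: "n \<ge> 1"

text \<open>Evaluates the definite description. Existence needs an increasing enumeration of
  \<open>X\<close>; uniqueness holds because the product of the linear factors of all other nodes
  isolates a single weight and has degree \<open>n - 1\<close>.\<close>

lemma interpolatory_formula_eq:
  assumes X: "finite X" "X \<subseteq> {-1..1}" "card X = n"
    and exact: "\<And>p :: real poly. degree p < n \<Longrightarrow> (\<Sum>y\<in>X. w y * poly p y) = integral {-1..1} (poly p)"
  shows "interpolatory_formula n X = (\<lambda>f. \<Sum>y\<in>X. w y * f y)"
  unfolding interpolatory_formula_def
proof (rule the_equality)
  \<comment> \<open>Formulas are indexed from 1, lists from 0.\<close>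
  define x where "x = (\<lambda>j. sorted_list_of_set X ! (j - 1))"
  have len: "length (sorted_list_of_set X) = n" using X by simp
  have mono: "strict_mono_on {1..n} x"
    by (intro strict_mono_onI)
       (use len strict_sorted_list_of_set[of X] in \<open>auto simp: x_def sorted_wrt_iff_nth_less\<close>)
  have img: "x ` {1..n} = X"
  proof -
    have "x ` {1..n} = (!) (sorted_list_of_set X) ` {0..<n}"
      unfolding x_def image_image[symmetric, of "(!) (sorted_list_of_set X)" "\<lambda>j. j - 1"]
      by (intro arg_cong[where f = "(`) ((!) (sorted_list_of_set X))"])
         (auto simp: image_iff intro!: bexI[of _ "Suc _"])
    also have "\<dots> = X" using X(1) len nth_image[of n "sorted_list_of_set X"] by simp
    finally show ?thesis .
  qed
  have bij: "bij_betw x {1..n} X"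
    using strict_mono_on_imp_inj_on[OF mono] img by (simp add: bij_betw_def)
  have Q: "(\<lambda>f. \<Sum>y\<in>X. w y * f y) = quadrature n (\<lambda>j. w (x j)) x"
    unfolding quadrature_def
    by (rule ext) (rule sum.reindex_bij_betw[OF bij, of "\<lambda>y. w y * _ y", symmetric])
  have "quadrature_nodes n x" using img mono X(2) by (auto simp: quadrature_nodes_def)
  then show "interpolatory n (\<lambda>f. \<Sum>y\<in>X. w y * f y) \<and>
      (\<exists>a x. quadrature_nodes n x \<and> x ` {1..n} = X \<and> (\<lambda>f. \<Sum>y\<in>X. w y * f y) = quadrature n a x)"
    using img exact Q unfolding interpolatory_def by blast
next
  fix Q assume "interpolatory n Q \<and> (\<exists>a x. quadrature_nodes n x \<and> x ` {1..n} = X \<and> Q = quadrature n a x)"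
  then obtain a x where Q: "interpolatory n Q" "quadrature_nodes n x" "x ` {1..n} = X" "Q = quadrature n a x"
    by blast
  have bij: "bij_betw x {1..n} X"
    using Q strict_mono_on_imp_inj_on by (auto simp: bij_betw_def quadrature_nodes_def)
  define v where "v y = a (the_inv_into {1..n} x y)" for y
  have Qv: "Q f = (\<Sum>y\<in>X. v y * f y)" for f
  proof -
    have "(\<Sum>y\<in>X. v y * f y) = (\<Sum>j\<in>{1..n}. v (x j) * f (x j))"
      by (rule sum.reindex_bij_betw[OF bij, symmetric])
    also have "\<dots> = Q f"
      unfolding Q(4) quadrature_def v_def
      by (intro sum.cong) (use bij in \<open>auto simp: bij_betw_def the_inv_into_f_f\<close>)
    finally show ?thesis by simp
  qed
  have "v y = w y" if y: "y \<in> X" for y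
  proof -
    define l where "l = (\<Prod>z\<in>X - {y}. [:- z, 1:])"
    have "card X > 0" using X(1) y by (auto simp: card_gt_0_iff)
    then have deg: "degree l < n"
      unfolding l_def using X y by (subst degree_prod_sum_eq) (auto simp: card_Diff_singleton)
    have l0: "poly l z = 0" if "z \<in> X - {y}" for z using that X(1) by (auto simp: l_def poly_prod)
    have ly: "poly l y \<noteq> 0" using X(1) by (auto simp: l_def poly_prod)
    have s: "(\<Sum>z\<in>X. u z * poly l z) = u y * poly l y" for u
      using X(1) y l0 by (subst sum.remove[of _ y]) (auto intro!: sum.neutral)
    have "(\<Sum>z\<in>X. v z * poly l z) = (\<Sum>z\<in>X. w z * poly l z)"
      using Q(1) Qv exact[OF deg] deg by (simp add: interpolatory_def)
    then show ?thesis using ly by (simp add: s)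
  qed
  then show "Q = (\<lambda>f. \<Sum>y\<in>X. w y * f y)"
    by (intro ext) (simp add: Qv cong: sum.cong)
qed

section \<open>Zeros and orthogonality of Legendre polynomials, positivity of Gauss weights\<close>

lemma poly_integrable_on: "poly p integrable_on {a..b::real}"
  by (intro integrable_continuous_real continuous_intros)

lemma integral_poly_pderiv:
  assumes "a \<le> (b::real)"
  shows "integral {a..b} (poly (pderiv p)) = poly p b - poly p a"
proof (rule integral_unique, rule fundamental_theorem_of_calculus[OF assms])
  show "(poly p has_vector_derivative poly (pderiv p) x) (at x within {a..b})" for x
    using poly_DERIV[of p x] by (auto simp: has_real_derivative_iff_has_vector_derivative
        intro: has_vector_derivative_at_within)
qed

lemma integral_poly_0 [simp]: "integral {a..b::real} (poly 0) = 0"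
proof -
  have "poly (0 :: real poly) = (\<lambda>x. 0)" by (rule ext) simp
  then show ?thesis by simp
qed

lemma integral_poly_sum:
  "finite J \<Longrightarrow> integral {a..b::real} (poly (\<Sum>j\<in>J. smult (c j) (p j))) = (\<Sum>j\<in>J. c j * integral {a..b} (poly (p j)))"
proof -
  assume J: "finite J"
  have "poly (\<Sum>j\<in>J. smult (c j) (p j)) = (\<lambda>x. \<Sum>j\<in>J. c j * poly (p j) x)"
    by (rule ext) (simp add: poly_sum)
  then show ?thesis
    by (simp add: integral_sum[OF J] integrable_on_mult_right poly_integrable_on)
qed

lemma integral_poly_diff:
  "integral {a..b::real} (poly (p - q)) = integral {a..b} (poly p) - integral {a..b} (poly q)"
proof -
  have "poly (p - q) = (\<lambda>x. poly p x - poly q x)" by (rule ext) simp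
  then show ?thesis by (simp add: integral_diff poly_integrable_on)
qed

text \<open>The induction carries the enclosing interval along, so that the root found between the
  old maximum and the new point differs from all earlier ones.\<close>

lemma pderiv_roots_Rolle:
  fixes p :: "real poly"
  assumes "finite A" "A \<noteq> {}" "\<And>x. x \<in> A \<Longrightarrow> poly p x = 0"
  shows "\<exists>B. finite B \<and> Suc (card B) = card A \<and> B \<subseteq> {Min A<..<Max A} \<and> (\<forall>x\<in>B. poly (pderiv p) x = 0)"
  using assms
proof (induction A rule: finite_linorder_max_induct)
  case (insert b A)
  show ?case
  proof (cases "A = {}")
    case True then show ?thesis by (intro exI[of _ "{}"]) auto
  next
    case False
    from insert.IH[OF False] insert.prems obtain B where
      B: "finite B" "Suc (card B) = card A" "B \<subseteq> {Min A<..<Max A}" "\<forall>x\<in>B. poly (pderiv p) x = 0" by auto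
    have lt: "Max A < b" using insert.hyps False by auto
    have MA: "Max A \<in> A" using insert.hyps False by auto
    obtain c where c: "Max A < c" "c < b" "poly p b - poly p (Max A) = (b - Max A) * poly (pderiv p) c"
      using poly_MVT[OF lt] by blast
    then have "poly (pderiv p) c = 0" using insert.prems MA lt by simp
    moreover have "c \<notin> B" using B(3) c by auto
    moreover have "Max (insert b A) = b" "Min (insert b A) = Min A"
      using insert.hyps False lt Max_ge[of A] Min_le[of A] MA
      by (auto simp: Max_insert Min_insert max_def min_def intro: less_imp_le) 
         (meson MA Min_le le_less_trans less_le_not_le)+
    moreover have "Min A \<le> Max A" using insert.hyps False by (simp add: MA)
    moreover have "b \<notin> A" using insert.hyps by auto
    ultimately show ?thesis
      using B c insert.hyps(1) by (intro exI[of _ "insert c B"]) auto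
  qed
qed simp

text \<open>Each derivative costs one factor \<open>w\<close>. With \<open>w = x^2 - 1\<close> this
  keeps both end points as zeros until the last derivative.\<close>

lemma dvd_higher_pderiv_power:
  fixes w :: "real poly"
  assumes "k \<le> n"
  shows "w ^ (n - k) dvd (pderiv ^^ k) (w ^ n)"
  using assms
proof (induction k)
  case (Suc k)
  then obtain q where q: "(pderiv ^^ k) (w ^ n) = w ^ (n - k) * q" by (auto simp: dvd_def)
  define j where "j = n - Suc k"
  have nk: "n - k = Suc j" "n - Suc k = j" using Suc by (auto simp: j_def)
  have "(pderiv ^^ Suc k) (w ^ n) = pderiv (w ^ Suc j * q)" by (simp only: funpow.simps o_apply q nk)
  also have "\<dots> = w ^ Suc j * pderiv q + q * (smult (of_nat (Suc j)) (w ^ j) * pderiv w)"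
    by (simp only: pderiv_mult pderiv_power_Suc)
  also have "\<dots> = w ^ j * (w * pderiv q + smult (of_nat (Suc j)) (q * pderiv w))"
    by (simp add: algebra_simps del: of_nat_Suc)
  finally have "(pderiv ^^ Suc k) (w ^ n) = w ^ (n - Suc k) * (w * pderiv q + smult (of_nat (Suc j)) (q * pderiv w))"
    by (simp only: nk)
  then show ?case by simp
qed simp

text \<open>The unnormalised Legendre polynomial is the case \<open>k = n\<close>; smaller
  \<open>k\<close> are the stages of the inductions for zeros and for integration by parts.\<close>

abbreviation rodrigues :: "nat \<Rightarrow> nat \<Rightarrow> real poly" where
  "rodrigues n k \<equiv> (pderiv ^^ k) ([:-1, 0, 1:] ^ n)"

lemma rodrigues_ends:
  assumes "k < n"
  shows "poly (rodrigues n k) 1 = 0" "poly (rodrigues n k) (-1) = 0"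
proof -
  obtain q where q: "rodrigues n k = [:-1, 0, 1:] ^ (n - k) * q"
    using dvd_higher_pderiv_power[of k n] assms by (auto simp: dvd_def)
  show "poly (rodrigues n k) 1 = 0" "poly (rodrigues n k) (-1) = 0"
    using assms by (auto simp: q poly_power)
qed

text \<open>The \<open>k\<close> inner zeros and the end points are \<open>k + 2\<close> zeros, so
  Rolle yields \<open>k + 1\<close> inner zeros of the next derivative.\<close>

lemma rodrigues_roots:
  assumes "k \<le> n"
  shows "\<exists>A. finite A \<and> card A = k \<and> A \<subseteq> {-1<..<1} \<and> (\<forall>x\<in>A. poly (rodrigues n k) x = 0)"
  using assms
proof (induction k)
  case 0 show ?case by (intro exI[of _ "{}"]) auto
next
  case (Suc k)
  then obtain A where A: "finite A" "card A = k" "A \<subseteq> {-1<..<1}" "\<forall>x\<in>A. poly (rodrigues n k) x = 0" by auto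
  define A' where "A' = insert 1 (insert (-1) A)"
  have "1 \<notin> insert (-1) A" "-1 \<notin> A" using A(3) by auto
  then have "card A' = Suc (Suc k)" using A by (simp add: A'_def)
  moreover have le: "-1 \<le> x \<and> x \<le> 1" if "x \<in> A'" for x
    using that A(3) by (force simp: A'_def)
  have "finite A'" "-1 \<in> A'" "1 \<in> A'" using A(1) by (auto simp: A'_def)
  then have "Min A' = -1" "Max A' = 1" using le by (auto intro!: Min_eqI Max_eqI)
  moreover have "finite A'" "A' \<noteq> {}" "\<And>x. x \<in> A' \<Longrightarrow> poly (rodrigues n k) x = 0"
    using A Suc.prems rodrigues_ends[of k n] by (auto simp: A'_def)
  ultimately show ?case
    using pderiv_roots_Rolle[of A' "rodrigues n k"] by auto
qed

lemma degree_rodrigues: "degree (rodrigues n k) = 2 * n - k"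
proof (induction k)
  case 0 show ?case by (simp add: degree_power_eq)
qed (simp add: degree_pderiv)

text \<open>Repeated integration by parts: the boundary terms vanish by
  \<open>rodrigues_ends\<close>, and \<open>q\<close> is differentiated until it disappears.\<close>

lemma rodrigues_orthogonal:
  assumes "k \<le> n" "degree q < k"
  shows "integral {-1..1} (poly (rodrigues n k * q)) = 0"
  using assms
proof (induction k arbitrary: q)
  case (Suc k)
  have "0 = integral {-1..1} (poly (pderiv (rodrigues n k * q)))"
    using Suc.prems by (subst integral_poly_pderiv) (auto simp: rodrigues_ends)
  also have "pderiv (rodrigues n k * q) = rodrigues n (Suc k) * q - (0 - rodrigues n k * pderiv q)"
    by (simp add: pderiv_mult)
  also have "integral {-1..1} (poly \<dots>) = integral {-1..1} (poly (rodrigues n (Suc k) * q)) +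
      integral {-1..1} (poly (rodrigues n k * pderiv q))"
    by (subst integral_poly_diff)
      (subst integral_poly_diff, simp)
  also have "integral {-1..1} (poly (rodrigues n k * pderiv q)) = 0"
  \<comment> \<open>For constant \<open>q\<close> the derivative still has degree 0, which is not
    below \<open>k\<close> when \<open>k = 0\<close>.\<close>
  proof (cases "degree q = 0")
    case True
    then have "pderiv q = 0" by (simp add: pderiv_eq_0_iff)
    then show ?thesis by simp
  next
    case False
    then show ?thesis using Suc.prems by (intro Suc.IH) (auto simp: degree_pderiv)
  qed
  finally show ?case by simp
qed simp

text \<open>The square of the Lagrange polynomial \<open>l y\<close> agrees with \<open>l y\<close>
  at all nodes, so the difference is \<open>P\<close> times a polynomial of degree below
  \<open>n\<close> and integrates to 0. The weight is thus the integral of a square.\<close>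

lemma gauss_quadrature_positive:
  assumes "n \<ge> 1"
  shows "\<exists>X w. positive_quadrature n X w \<and> gauss_quadrature n = (\<lambda>f. \<Sum>y\<in>X. w y * f y)"
proof -
  define P where "P = rodrigues n n"
  define X where "X = {x. poly P x = 0}"
  have degP: "degree P = n" by (simp add: P_def degree_rodrigues)
  then have P0: "P \<noteq> 0" using assms by auto
  have finX: "finite X" unfolding X_def using P0 by (rule poly_roots_finite)
  obtain A where A: "finite A" "card A = n" "A \<subseteq> {-1<..<1}" "\<forall>x\<in>A. poly P x = 0"
    using rodrigues_roots[of n n] by (auto simp: P_def)
  \<comment> \<open>The degree allows at most \<open>n\<close> zeros, so the \<open>n\<close> zeros
    found by Rolle are all of them.\<close>
  have "card X \<le> card A" using card_poly_roots_bound[OF P0] degP A by (simp add: X_def)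
  then have "X = A" using card_seteq[OF finX, of A] A by (auto simp: X_def)
  then have X: "X \<subseteq> {-1..1}" "card X = n" using A by auto
  define l0 where "l0 y = (\<Prod>z\<in>X - {y}. [:- z, 1::real:])" for y
  define l where "l y = smult (1 / poly (l0 y) y) (l0 y)" for y
  have degl: "degree (l y) \<le> n - 1" if "y \<in> X" for y
  proof -
    have "degree (l0 y) = n - 1"
      unfolding l0_def using X finX that by (subst degree_prod_sum_eq) (auto simp: card_Diff_singleton)
    then show ?thesis by (simp add: l_def)
  qed
  have ly: "poly (l y) z = (if z = y then 1 else 0)" if "y \<in> X" "z \<in> X" for y z
    using that finX by (auto simp: l_def l0_def poly_prod)
  define w where "w y = integral {-1..1} (poly (l y))" for y
  have exact: "(\<Sum>y\<in>X. w y * poly p y) = integral {-1..1} (poly p)" if p: "degree p < n" for p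
  proof -
    have "p = (\<Sum>y\<in>X. smult (poly p y) (l y))"
    proof (rule poly_eqI_degree[of X])
      fix z assume z: "z \<in> X"
      have "poly (\<Sum>y\<in>X. smult (poly p y) (l y)) z = (\<Sum>y\<in>X. if y = z then poly p y else 0)"
        unfolding poly_sum by (intro sum.cong) (auto simp: ly z)
      then show "poly p z = poly (\<Sum>y\<in>X. smult (poly p y) (l y)) z" using z finX by simp
    next
      have "degree (\<Sum>y\<in>X. smult (poly p y) (l y)) \<le> n - 1"
        by (intro degree_sum_le finX) (use degl degree_smult_le order_trans in blast)
      then show "degree (\<Sum>y\<in>X. smult (poly p y) (l y)) < card X" using X assms by simp
    qed (use p X in simp)
    then have "integral {-1..1} (poly p) = integral {-1..1} (poly (\<Sum>y\<in>X. smult (poly p y) (l y)))" by simp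
    also have "\<dots> = (\<Sum>y\<in>X. w y * poly p y)"
      by (subst integral_poly_sum[OF finX]) (simp add: w_def mult.commute)
    finally show ?thesis by simp
  qed
  have nonneg: "0 \<le> w y" if y: "y \<in> X" for y
  proof -
    define d where "d = l y * l y - l y"
    have "d mod P = 0"
    proof (rule poly_eqI_degree[of X])
      fix z assume z: "z \<in> X"
      have "poly d z = poly (d div P) z * poly P z + poly (d mod P) z"
        by (metis div_mult_mod_eq poly_add poly_mult)
      moreover have "poly d z = 0" using z y by (simp add: d_def ly)
      moreover have "poly P z = 0" using z by (simp add: X_def)
      ultimately show "poly (d mod P) z = poly 0 z" by simp
    next
      show "degree (d mod P) < card X" using degree_mod_less[OF P0, of d] degP X assms by auto
    qed (use X assms in simp)
    then obtain q where q: "d = P * q" by (auto simp: mod_eq_0_iff_dvd dvd_def)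
    have "degree d \<le> (n - 1) + (n - 1)"
      unfolding d_def using degree_mult_le[of "l y" "l y"] degl[OF y] by (intro degree_diff_le) auto
    then have "degree q < n"
      using degree_mult_eq[OF P0, of q] degP assms q by (cases "q = 0") auto
    then have "integral {-1..1} (poly d) = 0"
      unfolding q P_def by (intro rodrigues_orthogonal) auto
    then have "w y = integral {-1..1} (poly (l y * l y))"
      unfolding d_def integral_poly_diff w_def by simp
    also have "0 \<le> \<dots>" by (intro integral_nonneg poly_integrable_on) simp
    finally show ?thesis .
  qed
  have "{x. poly (legendre_poly n) x = 0} = X"
    by (auto simp: legendre_poly_def X_def P_def)
  then have "gauss_quadrature n = (\<lambda>f. \<Sum>y\<in>X. w y * f y)"
    unfolding gauss_quadrature_def using interpolatory_formula_eq[OF finX X exact] by simp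
  moreover have "positive_quadrature n X w"
    by unfold_locales (use finX X nonneg exact assms in auto)
  ultimately show ?thesis by blast
qed

section \<open>Clenshaw-Curtis weights\<close>

text \<open>Chebyshev polynomials of the first kind.\<close>

fun cos_poly :: "nat \<Rightarrow> real poly" where
  "cos_poly 0 = 1"
| "cos_poly (Suc 0) = [:0, 1:]"
| "cos_poly (Suc (Suc k)) = [:0, 2:] * cos_poly (Suc k) - cos_poly k"

lemma cos_poly_cos: "poly (cos_poly k) (cos t) = cos (real k * t)"
proof (induction k rule: cos_poly.induct)
  case (3 k)
  let ?x = "real (Suc k) * t"
  have "cos (real (Suc (Suc k)) * t) + cos (real k * t) = cos (?x + t) + cos (?x - t)"
    by (simp add: algebra_simps)
  also have "\<dots> = 2 * cos t * cos ?x" unfolding cos_add cos_diff by simp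
  finally show ?case using 3 by simp
qed auto

lemma coeff_cos_poly: "(\<forall>i>k. coeff (cos_poly k) i = 0) \<and> 0 < coeff (cos_poly k) k"
proof (induction k rule: cos_poly.induct)
  case (3 k)
  then show ?case by (auto simp: coeff_pCons split: nat.splits)
qed (auto simp: coeff_pCons split: nat.splits)

text \<open>The case \<open>k = 1\<close> relies on \<open>1 / 0 = 0\<close> and on the vanishing first factor.\<close>

definition cos_moment :: "nat \<Rightarrow> real" where
  "cos_moment k = (1 + (-1) ^ k) / 2 * (1 / (real k + 1) - 1 / (real k - 1))"

text \<open>With \<open>x = cos t\<close> the integral becomes that of
  \<open>cos (k * t) * sin t\<close> over \<open>[0, pi]\<close>. The substitution is carried out on
  primitives: \<open>poly q (cos t) + G t\<close> has derivative 0 and is constant.\<close>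

lemma integral_cos_poly: "integral {-1..1} (poly (cos_poly k)) = cos_moment k"
proof -
  obtain q where q: "pderiv q = cos_poly k"
    using poly_antiderivative by blast
  define c1 where "c1 = 1 / (2 * (real k + 1))"
  define c2 where "c2 = 1 / (2 * (real k - 1))"
  define G where "G t = cos ((real k - 1) * t) * c2 - cos ((real k + 1) * t) * c1" for t
  have dG: "(G has_real_derivative cos (real k * t) * sin t) (at t)" for t
  proof -
    have "(G has_real_derivative sin ((real k + 1) * t) * ((real k + 1) * c1) -
       sin ((real k - 1) * t) * ((real k - 1) * c2)) (at t)"
      unfolding G_def by (auto intro!: derivative_eq_intros)
    moreover have "sin ((real k + 1) * t) * ((real k + 1) * c1) = sin (real k * t + t) / 2"
    proof -
      have "real k + 1 \<noteq> 0" by linarith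
      then have "(real k + 1) * c1 = 1 / 2" by (simp only: c1_def) simp
      moreover have "(real k + 1) * t = real k * t + t" by (simp add: distrib_right)
      ultimately show ?thesis by simp
    qed
    moreover have "sin ((real k - 1) * t) * ((real k - 1) * c2) = sin (real k * t - t) / 2"
    \<comment> \<open>For \<open>k = 1\<close> both sides contain the sine of 0, whatever the value
      of \<open>c2\<close>.\<close>
    proof (cases "k = 1")
      case False
      then have "real k - 1 \<noteq> 0" by simp
      then have "(real k - 1) * c2 = 1 / 2" by (simp only: c2_def) simp
      moreover have "(real k - 1) * t = real k * t - t" by (simp add: left_diff_distrib)
      ultimately show ?thesis by simp
    qed simp
    moreover have "sin (real k * t + t) / 2 - sin (real k * t - t) / 2 = cos (real k * t) * sin t"
      by (simp add: sin_add sin_diff diff_divide_distrib add_divide_distrib)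
    ultimately show ?thesis by (simp only:)
  qed
  have "poly q (cos pi) + G pi = poly q (cos 0) + G 0"
  proof (rule DERIV_isconst_all[where f = "\<lambda>t. poly q (cos t) + G t"], rule allI)
    fix t
    have "((\<lambda>t. poly q (cos t)) has_real_derivative poly (pderiv q) (cos t) * - sin t) (at t)"
      by (rule DERIV_chain2[OF poly_DERIV]) (auto intro!: derivative_eq_intros)
    from DERIV_add[OF this dG]
    show "((\<lambda>t. poly q (cos t) + G t) has_real_derivative 0) (at t)"
      by (simp add: q cos_poly_cos)
  qed
  then have "integral {-1..1} (poly (cos_poly k)) = G pi - G 0"
    using integral_poly_pderiv[of "-1" 1 q] by (simp add: q)
  also have "\<dots> = cos_moment k"
  proof -
    have "cos ((real k + 1) * pi) = - ((-1) ^ k)" "cos ((real k - 1) * pi) = - ((-1) ^ k)"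
      by (simp_all add: distrib_right left_diff_distrib cos_diff)
    then have "G pi - G 0 = (1 + (-1) ^ k) * (c1 - c2)" by (simp add: G_def algebra_simps)
    also have "c1 - c2 = (1 / (real k + 1) - 1 / (real k - 1)) / 2" unfolding c1_def c2_def by (simp only: diff_divide_distrib divide_divide_eq_left mult.commute)
    finally show ?thesis by (simp add: cos_moment_def)
  qed
  finally show ?thesis .
qed

text \<open>Odd moments vanish, and for even \<open>k\<close> the modulus is
  \<open>1 / (k - 1) - 1 / (k + 1)\<close>, which telescopes; the conditional tracks the last even
  index.\<close>

lemma sum_abs_cos_moment: "(\<Sum>k=1..N. \<bar>cos_moment k\<bar>) \<le> 1 - 1 / real (if even N then N + 1 else N)"
proof (induction N)
  case (Suc N)
  show ?case
  proof (cases "even N")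
    case True
    then have "cos_moment (Suc N) = 0" by (simp add: cos_moment_def)
    then show ?thesis using Suc True by simp
  next
    case False
    then have "N > 0" by (auto intro: Nat.gr0I)
    then have "1 / (real N + 2) \<le> 1 / real N" by (simp add: frac_le)
    then have "\<bar>cos_moment (Suc N)\<bar> = 1 / real N - 1 / (real N + 2)"
      using False by (simp add: cos_moment_def add.commute[of 2])
    then show ?thesis using Suc False by (simp add: add.commute[of 2])
  qed
qed simp

section \<open>Trapezoidal rule in the angle and discrete orthogonality of cosines\<close>

definition trapezoid_weight :: "nat \<Rightarrow> nat \<Rightarrow> real" where
  "trapezoid_weight N j = (if j = 0 \<or> j = N then 1 / 2 else 1) / real N"

lemma sum_trapezoid_weight:
  assumes "N \<ge> 1"
  shows "(\<Sum>j\<le>N. trapezoid_weight N j * f j) = (\<Sum>j<N. f j + f (Suc j)) / (2 * real N)"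
proof -
  have "(\<Sum>j<N. f j + f (Suc j)) = (\<Sum>j\<le>N. f j) - f N + ((\<Sum>j\<le>N. f j) - f 0)"
  proof -
    have "(\<Sum>j\<le>N. f j) = (\<Sum>j<N. f j) + f N" by (simp flip: lessThan_Suc_atMost)
    moreover have "(\<Sum>j\<le>N. f j) = f 0 + (\<Sum>j<N. f (Suc j))"
      by (simp only: lessThan_Suc_atMost[symmetric] sum.lessThan_Suc_shift)
    ultimately show ?thesis by (simp add: sum.distrib)
  qed
  moreover have "\<dots> / (2 * real N) = (\<Sum>j\<le>N. f j) / N - f 0 / (2 * N) - f N / (2 * N)"
    using assms by (simp add: field_simps)
  moreover have "(\<Sum>j\<le>N. trapezoid_weight N j * f j) =
      (\<Sum>j\<le>N. f j / N - (if j = 0 then f j / (2 * N) else 0) - (if j = N then f j / (2 * N) else 0))"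
    using assms by (intro sum.cong) (auto simp: trapezoid_weight_def field_simps)
  moreover have "\<dots> = (\<Sum>j\<le>N. f j) / N - f 0 / (2 * N) - f N / (2 * N)"
    by (simp add: sum_subtractf sum_divide_distrib)
  ultimately show ?thesis by (simp only:)
qed

text \<open>Multiplied by \<open>sin (a / 2)\<close>, the sum over neighbouring pairs telescopes to
  a multiple of \<open>sin (m * pi) = 0\<close>. The range of \<open>m\<close> puts
  \<open>a / 2\<close> strictly between 0 and \<open>pi\<close>, so the factor can be
  cancelled.\<close>

lemma trapezoid_cos_eq_0:
  assumes "0 < m" "m < 2 * N"
  shows "(\<Sum>j\<le>N. trapezoid_weight N j * cos (real m * (real j * pi / real N))) = 0"
proof -
  define a where "a = real m * pi / real N"
  have N: "N \<ge> 1" using assms by simp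
  have "sin (a / 2) * (\<Sum>j<N. cos (real j * a) + cos (real (Suc j) * a)) =
      (\<Sum>j<N. cos (a / 2) * (sin (real (Suc j) * a) - sin (real j * a)))"
    unfolding sum_distrib_left
  proof (intro sum.cong refl)
    fix j
    define y where "y = real j * a + a / 2"
    have *: "real j * a = y - a / 2" "real (Suc j) * a = y + a / 2" by (simp_all add: y_def algebra_simps)
    show "sin (a / 2) * (cos (real j * a) + cos (real (Suc j) * a)) =
        cos (a / 2) * (sin (real (Suc j) * a) - sin (real j * a))"
      unfolding * by (simp add: sin_add sin_diff cos_add cos_diff)
  qed
  also have "\<dots> = cos (a / 2) * (sin (real N * a) - sin (real 0 * a))"
    using sum_lessThan_telescope[of "\<lambda>j. sin (real j * a)" N] by (simp only: sum_distrib_left[symmetric])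
  also have "real N * a = real m * pi" using N by (simp add: a_def)
  finally have "sin (a / 2) * (\<Sum>j<N. cos (real j * a) + cos (real (Suc j) * a)) = 0" by simp
  moreover have "sin (a / 2) > 0"
  proof (rule sin_gt_zero)
    show "0 < a / 2" using assms by (simp add: a_def)
    have "real m < 2 * real N" using assms by (metis of_nat_less_iff of_nat_mult of_nat_numeral)
    then show "a / 2 < pi" using N by (simp add: a_def field_simps)
  qed
  ultimately have "(\<Sum>j<N. cos (real j * a) + cos (real (Suc j) * a)) = 0" by simp
  moreover have "real m * (real j * pi / real N) = real j * a" for j by (simp add: a_def)
  ultimately show ?thesis by (simp only: sum_trapezoid_weight[OF N])
qed

text \<open>Aliasing: on the grid the frequency \<open>2 * N\<close> cannot be told from 0. This
  gives \<open>k = N\<close> the square norm 1 instead of \<open>1 / 2\<close>.\<close>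

lemma trapezoid_cos_eq_1:
  assumes "m = 0 \<or> m = 2 * N" "N \<ge> 1"
  shows "(\<Sum>j\<le>N. trapezoid_weight N j * cos (real m * (real j * pi / real N))) = 1"
proof -
  have one: "cos (real m * (real j * pi / real N)) = 1" for j
  proof -
    have "real m * (real j * pi / real N) = 0 \<or> real m * (real j * pi / real N) = 2 * real j * pi"
      using assms by auto
    then show ?thesis by (metis cos_2npi cos_zero)
  qed
  show ?thesis
    using assms(2) sum_trapezoid_weight[OF assms(2), of "\<lambda>_. 1"] unfolding one by simp
qed

text \<open>The product formula leaves the frequencies \<open>k - l\<close> and
  \<open>k + l\<close>; the latter reaches 0 or \<open>2 * N\<close> only for
  \<open>k = l = 0\<close> or \<open>k = l = N\<close>.\<close>

lemma trapezoid_cos_orthogonal: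
  assumes "k \<le> N" "l \<le> N" "N \<ge> 1"
  shows "(\<Sum>j\<le>N. trapezoid_weight N j * (cos (real k * (real j * pi / real N)) * cos (real l * (real j * pi / real N))))
    = (if k \<noteq> l then 0 else if k = 0 \<or> k = N then 1 else 1 / 2)"
proof -
  define E where "E m = (\<Sum>j\<le>N. trapezoid_weight N j * cos (real m * (real j * pi / real N)))" for m
  have sym: "(\<Sum>j\<le>N. trapezoid_weight N j * (cos (real k * (real j * pi / real N)) * cos (real l * (real j * pi / real N))))
    = (if k \<noteq> l then 0 else if k = 0 \<or> k = N then 1 else 1 / 2)" if "l \<le> k" "k \<le> N" for k l
  proof -
    have *: "cos (real k * t) * cos (real l * t) = (cos (real (k - l) * t) + cos (real (k + l) * t)) / 2" for t
      using that by (simp add: of_nat_diff distrib_right left_diff_distrib cos_add cos_diff)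
    have "(\<Sum>j\<le>N. trapezoid_weight N j * (cos (real k * (real j * pi / real N)) * cos (real l * (real j * pi / real N))))
        = (E (k - l) + E (k + l)) / 2"
      unfolding * E_def by (simp add: sum.distrib[symmetric] sum_divide_distrib distrib_left)
    moreover have "E (k - l) = (if k = l then 1 else 0)"
      unfolding E_def using that assms(3) trapezoid_cos_eq_0[of "k - l" N] trapezoid_cos_eq_1[of "k - l" N] by auto
    moreover have "E (k + l) = (if k = l \<and> (k = 0 \<or> k = N) then 1 else 0)"
    proof (cases "k = l \<and> (k = 0 \<or> k = N)")
      case True
      then show ?thesis unfolding E_def using assms(3) trapezoid_cos_eq_1[of "k + l" N] by auto
    next
      case False
      then have "0 < k + l" "k + l < 2 * N" using that by auto
      then show ?thesis unfolding E_def using False trapezoid_cos_eq_0[of "k + l" N] by auto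
    qed
    ultimately show ?thesis by auto
  qed
  show ?thesis
  proof (cases "l \<le> k")
    case True then show ?thesis by (intro sym assms)
  next
    case False
    then show ?thesis
      using sym[of k l] assms(2) by (subst mult.commute[of "cos (real k * _)"]) simp
  qed
qed

text \<open>The \<open>T k\<close> are triangular with respect to the monomials, so subtracting a
  multiple of \<open>T d\<close> removes the leading coefficient without changing
  \<open>F\<close>.\<close>

lemma linear_functional_eq_0:
  fixes F :: "real poly \<Rightarrow> real" and T :: "nat \<Rightarrow> real poly"
  assumes add: "\<And>p c q. F (p + smult c q) = F p + c * F q"
    and T: "\<And>k. k < n \<Longrightarrow> (\<forall>i>k. coeff (T k) i = 0) \<and> coeff (T k) k \<noteq> 0 \<and> F (T k) = 0"
    and p: "degree p < n"
  shows "F p = 0"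
proof -
  have "F p = 0" if "d \<le> n" "\<forall>i\<ge>d. coeff p i = 0" for d p
    using that
  proof (induction d arbitrary: p)
    case 0
    then have "p = 0" by (simp add: poly_eq_iff)
    \<comment> \<open>Linearity at zero polynomials with factor -1 reads
      \<open>F 0 = F 0 - F 0\<close>.\<close>
    then show ?case using add[of 0 "-1" 0] by simp
  next
    case (Suc d)
    let ?c = "coeff p d / coeff (T d) d"
    have "F (p + smult (- ?c) (T d)) = 0"
    proof (rule Suc.IH)
      show "\<forall>i\<ge>d. coeff (p + smult (- ?c) (T d)) i = 0"
      proof (intro allI impI)
        fix i assume "d \<le> i"
        then show "coeff (p + smult (- ?c) (T d)) i = 0"
          using T[of d] Suc.prems by (cases "i = d") auto
      qed
    qed (use Suc.prems in simp)
    then show ?case using add[of p "- ?c" "T d"] T[of d] Suc.prems by simp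
  qed
  from this[of n p] show ?thesis using p coeff_eq_0[of p] by simp
qed

text \<open>
  By discrete orthogonality the weights are the trapezoidal weights times the cosine polynomial with
  the moments \<open>c\<^sub>k = \<integral> T\<^sub>k\<close> as coefficients; it is nonnegative because \<open>2 \<Sum>\<^sub>k\<^sub>\<ge>\<^sub>1 \<bar>c\<^sub>k\<bar> \<le> 2 = c\<^sub>0\<close>.
\<close>

lemma clenshaw_curtis_quadrature_positive:
  assumes "n \<ge> 2"
  shows "\<exists>X w. positive_quadrature n X w \<and> clenshaw_curtis_quadrature n = (\<lambda>f. \<Sum>y\<in>X. w y * f y)"
proof -
  define N where "N = n - 1"
  have N: "N \<ge> 1" "n = Suc N" using assms by (auto simp: N_def)
  define \<theta> where "\<theta> j = real j * pi / real N" for j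
  \<comment> \<open>Reciprocals of the discrete square norms of the cosines.\<close>
  define \<gamma> :: "nat \<Rightarrow> real" where "\<gamma> k = (if k = 0 \<or> k = N then 1 else 2)" for k
  define a where "a j = trapezoid_weight N j * (\<Sum>k\<le>N. \<gamma> k * cos_moment k * cos (real k * \<theta> j))" for j
  define X where "X = (\<lambda>j. cos (\<theta> j)) ` {..N}"
  have \<theta>: "0 \<le> \<theta> j" "\<theta> j \<le> pi" if "j \<le> N" for j
    using that N by (auto simp: \<theta>_def field_simps)
  have inj: "inj_on (\<lambda>j. cos (\<theta> j)) {..N}"
  proof (rule inj_onI)
    fix i j assume ij: "i \<in> {..N}" "j \<in> {..N}" "cos (\<theta> i) = cos (\<theta> j)"
    then have "\<theta> i = \<theta> j" using \<theta> cos_inj_pi[of "\<theta> i" "\<theta> j"] by simp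
    then show "i = j" using N by (simp add: \<theta>_def)
  qed
  have X: "finite X" "X \<subseteq> {-1..1}" "card X = n"
    using inj N by (auto simp: X_def card_image)
  have bij: "bij_betw (\<lambda>j. cos (\<theta> j)) {..N} X" using inj by (simp add: X_def bij_betw_def)
  define w where "w y = a (the_inv_into {..N} (\<lambda>j. cos (\<theta> j)) y)" for y
  have w: "w (cos (\<theta> j)) = a j" if "j \<le> N" for j
    using the_inv_into_f_f[OF inj, of j] that by (simp add: w_def)
  have sumX: "(\<Sum>y\<in>X. w y * f y) = (\<Sum>j\<le>N. a j * f (cos (\<theta> j)))" for f
    unfolding sum.reindex_bij_betw[OF bij, of "\<lambda>y. w y * f y", symmetric]
    by (intro sum.cong) (auto simp: w)
  have a: "0 \<le> a j" for j
  proof -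
    have "\<bar>\<Sum>k=1..N. \<gamma> k * cos_moment k * cos (real k * \<theta> j)\<bar> \<le> (\<Sum>k=1..N. 2 * \<bar>cos_moment k\<bar>)"
    proof (rule order_trans[OF sum_abs], rule sum_mono)
      fix k
      have "\<bar>\<gamma> k * cos_moment k * cos (real k * \<theta> j)\<bar> = \<bar>\<gamma> k\<bar> * \<bar>cos_moment k\<bar> * \<bar>cos (real k * \<theta> j)\<bar>"
        by (simp add: abs_mult)
      also have "\<dots> \<le> 2 * \<bar>cos_moment k\<bar> * 1"
        by (intro mult_mono) (auto simp: \<gamma>_def)
      finally show "\<bar>\<gamma> k * cos_moment k * cos (real k * \<theta> j)\<bar> \<le> 2 * \<bar>cos_moment k\<bar>" by simp
    qed
    also have "\<dots> \<le> 2"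
    proof -
      have "0 \<le> 1 / real (if even N then N + 1 else N)" by simp
      then have "(\<Sum>k=1..N. \<bar>cos_moment k\<bar>) \<le> 1"
        using sum_abs_cos_moment[of N] by linarith
      then show ?thesis by (simp flip: sum_distrib_left)
    qed
    finally have "\<bar>\<Sum>k=1..N. \<gamma> k * cos_moment k * cos (real k * \<theta> j)\<bar> \<le> 2" .
    moreover have "(\<Sum>k\<le>N. \<gamma> k * cos_moment k * cos (real k * \<theta> j)) =
        2 + (\<Sum>k=1..N. \<gamma> k * cos_moment k * cos (real k * \<theta> j))"
      unfolding atMost_atLeast0 by (subst sum.atLeast_Suc_atMost) (auto simp: \<gamma>_def cos_moment_def)
    ultimately have "0 \<le> (\<Sum>k\<le>N. \<gamma> k * cos_moment k * cos (real k * \<theta> j))" by linarith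
    moreover have "0 \<le> trapezoid_weight N j" by (simp add: trapezoid_weight_def)
    ultimately show ?thesis unfolding a_def by (rule mult_nonneg_nonneg[rotated])
  qed
  have moments: "(\<Sum>j\<le>N. a j * cos (real l * \<theta> j)) = cos_moment l" if l: "l \<le> N" for l
  proof -
    have "(\<Sum>j\<le>N. a j * cos (real l * \<theta> j)) =
      (\<Sum>j\<le>N. \<Sum>k\<le>N. \<gamma> k * cos_moment k * (trapezoid_weight N j * (cos (real k * \<theta> j) * cos (real l * \<theta> j))))"
      unfolding a_def sum_distrib_left sum_distrib_right by (intro sum.cong refl) (simp add: mult_ac)
    also have "\<dots> = (\<Sum>k\<le>N. \<gamma> k * cos_moment k * (\<Sum>j\<le>N. trapezoid_weight N j * (cos (real k * \<theta> j) * cos (real l * \<theta> j))))"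
      unfolding sum_distrib_left by (rule sum.swap)
    also have "\<dots> = (\<Sum>k\<le>N. if k = l then cos_moment k else 0)"
      unfolding \<theta>_def by (intro sum.cong refl, subst trapezoid_cos_orthogonal) (use l N in \<open>auto simp: \<gamma>_def\<close>)
    also have "\<dots> = cos_moment l" using l by simp
    finally show ?thesis .
  qed
  have exact: "(\<Sum>y\<in>X. w y * poly p y) = integral {-1..1} (poly p)" if p: "degree p < n" for p
  proof -
    define F where "F p = (\<Sum>y\<in>X. w y * poly p y) - integral {-1..1} (poly p)" for p
    have "F p = 0"
    \<comment> \<open>Exactness is tested on Chebyshev polynomials, where both sides are the moments
      \<open>cos_moment k\<close>.\<close>
    proof (rule linear_functional_eq_0[OF _ _ p, where T = cos_poly])
      fix p q :: "real poly" and c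
      have "integral {-1..1} (poly (p + smult c q)) = integral {-1..1} (poly p) + c * integral {-1..1} (poly q)"
        using integral_poly_sum[of "{True, False}" "-1" 1 "\<lambda>b. if b then 1 else c" "\<lambda>b. if b then p else q"]
        by simp
      then show "F (p + smult c q) = F p + c * F q"
        by (simp add: F_def sum.distrib distrib_left sum_distrib_left right_diff_distrib mult_ac)
    next
      fix k assume "k < n"
      then have "(\<Sum>y\<in>X. w y * poly (cos_poly k) y) = cos_moment k"
        unfolding sumX using N moments[of k] by (simp add: cos_poly_cos)
      then show "(\<forall>i>k. coeff (cos_poly k) i = 0) \<and> coeff (cos_poly k) k \<noteq> 0 \<and> F (cos_poly k) = 0"
        using coeff_cos_poly[of k] by (auto simp: F_def integral_cos_poly)
    qed
    then show ?thesis by (simp add: F_def)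
  qed
  have "(\<lambda>j. cos ((real j - 1) * pi / (real n - 1))) ` {1..n} = X"
  proof -
    have "{1..n} = Suc ` {..N}" using N by (simp add: atMost_atLeast0)
    then show ?thesis by (simp add: X_def image_image \<theta>_def N)
  qed
  then have Q: "clenshaw_curtis_quadrature n = (\<lambda>f. \<Sum>y\<in>X. w y * f y)"
    unfolding clenshaw_curtis_quadrature_def using interpolatory_formula_eq[OF X exact] by simp
  have "0 \<le> w y" for y by (simp add: w_def a)
  then have "positive_quadrature n X w"
    by unfold_locales (use X exact N in auto)
  with Q show ?thesis by blast
qed

section \<open>Error of positive quadrature formulas\<close>

context positive_quadrature
begin

definition remainder :: "(real \<Rightarrow> real) \<Rightarrow> real" where
  "remainder f = integral {-1..1} f - (\<Sum>y\<in>X. w y * f y)"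

lemma remainder_poly: "degree p < n \<Longrightarrow> remainder (poly p) = 0"
  by (simp add: remainder_def exact)

lemma remainder_cong: "(\<And>x. x \<in> {-1..1} \<Longrightarrow> f x = g x) \<Longrightarrow> remainder f = remainder g"
  unfolding remainder_def using nodes
  by (intro arg_cong2[where f = "(-)"] integral_cong sum.cong) auto

lemma remainder_add:
  "f integrable_on {-1..1} \<Longrightarrow> g integrable_on {-1..1} \<Longrightarrow> remainder (\<lambda>x. f x + g x) = remainder f + remainder g"
  by (simp add: remainder_def integral_add sum.distrib distrib_left)

lemma remainder_cmul: "remainder (\<lambda>x. c * f x) = c * remainder f"
  by (simp add: remainder_def sum_distrib_left right_diff_distrib mult_ac)

lemma remainder_diff:
  assumes "f integrable_on {-1..1}" "g integrable_on {-1..1}"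
  shows "remainder (\<lambda>x. f x - g x) = remainder f - remainder g"
  using remainder_add[OF assms(1) integrable_cmul[OF assms(2), of "-1"]] remainder_cmul[of "-1" g] by simp

lemma remainder_sum:
  assumes "finite J" "\<And>j. j \<in> J \<Longrightarrow> f j integrable_on {-1..1}"
  shows "remainder (\<lambda>x. \<Sum>j\<in>J. f j x) = (\<Sum>j\<in>J. remainder (f j))"
  using assms
proof (induction J)
  case empty show ?case by (simp add: remainder_def)
next
  case (insert j J)
  then show ?case by (simp add: remainder_add integrable_sum)
qed

text \<open>The integral and the quadrature sum are each bounded by the integral of
  \<open>M\<close>, the sum because nonnegative weights preserve the inequality and the formula is
  exact on \<open>M\<close>.\<close>

lemma remainder_le:
  assumes "f integrable_on {-1..1}" "degree M < n" "\<And>x. x \<in> {-1..1} \<Longrightarrow> \<bar>f x\<bar> \<le> poly M x"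
  shows "\<bar>remainder f\<bar> \<le> 2 * integral {-1..1} (poly M)"
proof -
  have "norm (integral {-1..1} f) \<le> integral {-1..1} (poly M)"
    using assms by (intro integral_norm_bound_integral poly_integrable_on) auto
  moreover have "\<bar>\<Sum>y\<in>X. w y * f y\<bar> \<le> (\<Sum>y\<in>X. w y * poly M y)"
    using assms(3) nodes weight_nonneg
    by (intro order_trans[OF sum_abs] sum_mono) (auto simp: abs_mult intro!: mult_left_mono)
  ultimately show ?thesis using exact[OF assms(2)] by (simp add: remainder_def)
qed

lemma remainder_bound:
  assumes "f integrable_on {-1..1}" "\<And>x. x \<in> {-1..1} \<Longrightarrow> \<bar>f x\<bar> \<le> B"
  shows "\<bar>remainder f\<bar> \<le> 4 * B"
proof -
  have "poly [:B:] = (\<lambda>x. B)" by (rule ext) simp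
  then have "integral {-1..1} (poly [:B:]) = 2 * B" by simp
  then show ?thesis using remainder_le[of f "[:B:]"] assms n_pos by simp
qed

text \<open>The \<open>J\<close> up-sets enter with coefficient \<open>1 / N\<close>, so together
  they cost at most \<open>\<epsilon>\<close> times the increment of \<open>h\<close>. The constant
  \<open>h (-1)\<close> integrates to a polynomial of degree at most \<open>s\<close>, which is
  exact. The approximation error \<open>4 * 2 ^ s / N\<close> disappears as \<open>N\<close> grows
  with the formula fixed.\<close>

lemma remainder_iint_mono:
  assumes h: "mono_on {-1..1} h" and "s < n" and \<epsilon>: "0 \<le> \<epsilon>"
    and step: "\<And>U t. t \<in> {-1..1} \<Longrightarrow> {t<..1} \<subseteq> U \<Longrightarrow> U \<subseteq> {t..1} \<Longrightarrow>
      \<bar>remainder (\<lambda>x. (x - t) ^ s * indicat_real U x)\<bar> \<le> \<epsilon>"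
  shows "\<bar>remainder (iint s h)\<bar> \<le> \<epsilon> * (h 1 - h (-1))"
proof -
  have hint: "h integrable_on {-1..1}" by (rule integrable_on_mono_on[OF h])
  have ups: "indicat_real U integrable_on {-1..1} \<and> \<bar>remainder (iint s (indicat_real U))\<bar> \<le> \<epsilon>"
    if U: "U \<subseteq> {-1..1}" "\<And>x y. x \<in> U \<Longrightarrow> x \<le> y \<Longrightarrow> y \<le> 1 \<Longrightarrow> y \<in> U" for U
  proof
    have "mono_on {-1..1} (indicat_real U)"
      using U(2) by (intro mono_onI) (auto simp: indicator_def)
    then show "indicat_real U integrable_on {-1..1}" by (rule integrable_on_mono_on)
    show "\<bar>remainder (iint s (indicat_real U))\<bar> \<le> \<epsilon>"
    \<comment> \<open>\<open>Inf {}\<close> carries no information. The zero function is written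
      \<open>0 * 0\<close> to fit \<open>remainder_cmul\<close>.\<close>
    proof (cases "U = {}")
      case True
      have "remainder (iint s (indicat_real U)) = remainder (\<lambda>x. 0 * 0)"
      proof (rule remainder_cong)
        fix x :: real assume "x \<in> {-1..1}"
        moreover have "indicat_real U = (\<lambda>_. 0)" using True by (intro ext) simp
        ultimately show "iint s (indicat_real U) x = 0 * 0" using iint_const[of x s 0] by simp
      qed
      then show ?thesis using \<epsilon> remainder_cmul[of 0] by simp
    next
      case False
      have bdd: "bdd_below U" using U(1) by (meson bdd_below_Icc bdd_below_mono)
      have low: "Inf U \<le> x" if "x \<in> U" for x using cInf_lower[OF that bdd] .
      have "{Inf U<..1} \<subseteq> U"
      proof
        fix x assume "x \<in> {Inf U<..1}"
        then obtain z where "z \<in> U" "z < x" using cInf_lessD[OF False, of x] by auto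
        then show "x \<in> U" using U(2)[of z x] \<open>x \<in> {Inf U<..1}\<close> by auto
      qed
      moreover have "U \<subseteq> {Inf U..1}" using U(1) low by auto
      moreover have "Inf U \<in> {-1..1}"
      proof -
        obtain u where "u \<in> U" using False by blast
        then have "Inf U \<le> 1" using low[of u] U(1) by force
        moreover have "-1 \<le> Inf U" using U(1) False by (intro cInf_greatest) auto
        ultimately show ?thesis by simp
      qed
      ultimately have le: "\<bar>remainder (\<lambda>x. (x - Inf U) ^ s * indicat_real U x)\<bar> \<le> \<epsilon>" by (intro step)
      have "remainder (iint s (indicat_real U)) = remainder (\<lambda>x. 1 / fact s * ((x - Inf U) ^ s * indicat_real U x))"
      proof (rule remainder_cong)
        fix x :: real assume x: "x \<in> {-1..1}"
        have "iint s (indicat_real U) x = (x - Inf U) ^ s / fact s * indicat_real U x"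
          by (rule iint_indicator_upset[OF U(1) False _ x]) (rule U(2))
        then show "iint s (indicat_real U) x = 1 / fact s * ((x - Inf U) ^ s * indicat_real U x)" by simp
      qed
      then have "\<bar>remainder (iint s (indicat_real U))\<bar> =
          1 / fact s * \<bar>remainder (\<lambda>x. (x - Inf U) ^ s * indicat_real U x)\<bar>"
        unfolding remainder_cmul by (simp add: abs_mult)
      also have "\<dots> \<le> 1 * \<epsilon>" using le by (intro mult_mono) (auto simp: fact_ge_1)
      finally show ?thesis by simp
    qed
  qed
  have approx: "\<bar>remainder (iint s h)\<bar> \<le> \<epsilon> * (h 1 - h (-1)) + 4 * 2 ^ s / real N" if N: "N > 0" for N :: nat
  proof -
    obtain J and U :: "nat \<Rightarrow> real set" where J: "real J \<le> real N * (h 1 - h (-1))"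
      and U: "\<And>i. U i \<subseteq> {-1..1}" "\<And>i x y. x \<in> U i \<Longrightarrow> x \<le> y \<Longrightarrow> y \<le> 1 \<Longrightarrow> y \<in> U i"
      and app: "\<And>x. x \<in> {-1..1} \<Longrightarrow> \<bar>h x - (h (-1) + (\<Sum>i<J. indicat_real (U i) x) / N)\<bar> \<le> 1 / N"
      using mono_on_approx_upsets[OF h N] by blast
    note Uint = ups[OF U, THEN conjunct1] and Ule = ups[OF U, THEN conjunct2]
    define g where "g x = (\<Sum>i<J. indicat_real (U i) x)" for x
    define k where "k x = h (-1) + 1 / N * g x" for x
    have gint: "g integrable_on {-1..1}" unfolding g_def by (intro integrable_sum Uint) auto
    have g1int: "(\<lambda>x. 1 / N * g x) integrable_on {-1..1}" by (rule integrable_on_mult_right[OF gint])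
    have kint: "k integrable_on {-1..1}" unfolding k_def by (intro integrable_add g1int) auto
    have dint: "(\<lambda>x. h x - k x) integrable_on {-1..1}" by (intro integrable_diff hint kint)
    have 1: "\<bar>remainder (iint s (\<lambda>x. h x - k x))\<bar> \<le> 4 * (1 / N * 2 ^ s)"
      by (intro remainder_bound iint_bound iint_integrable dint) (use app in \<open>simp_all add: k_def g_def\<close>)
    have 2: "remainder (iint s (\<lambda>x. h x - k x)) = remainder (iint s h) - remainder (iint s k)"
      by (subst remainder_diff[symmetric]) (auto intro!: iint_integrable hint kint remainder_cong iint_diff)
    have "remainder (iint s (\<lambda>_. h (-1))) = remainder (poly (smult (h (-1) / fact s) ([:1, 1:] ^ s)))"
      by (intro remainder_cong) (simp add: iint_const add.commute)
    also have "\<dots> = 0"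
      by (intro remainder_poly le_less_trans[OF degree_power_linear_le \<open>s < n\<close>])
    finally have 3: "remainder (iint s (\<lambda>_. h (-1))) = 0" .
    have "remainder (iint s k) = remainder (\<lambda>x. iint s (\<lambda>_. h (-1)) x + 1 / N * (\<Sum>i<J. iint s (indicat_real (U i)) x))"
    proof (rule remainder_cong)
      fix x :: real assume x: "x \<in> {-1..1}"
      have "iint s k x = iint s (\<lambda>_. h (-1)) x + iint s (\<lambda>x. 1 / N * g x) x"
        unfolding k_def by (intro iint_add g1int x) auto
      also have "iint s (\<lambda>x. 1 / N * g x) x = 1 / N * iint s g x" by (rule iint_cmul[OF x])
      also have "iint s g x = (\<Sum>i<J. iint s (indicat_real (U i)) x)"
        unfolding g_def by (intro iint_sum x Uint) auto
      finally show "iint s k x = iint s (\<lambda>_. h (-1)) x + 1 / N * (\<Sum>i<J. iint s (indicat_real (U i)) x)" .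
    qed
    also have "\<dots> = 1 / N * (\<Sum>i<J. remainder (iint s (indicat_real (U i))))"
      by (subst remainder_add) (auto intro!: iint_integrable Uint integrable_sum integrable_on_mult_right
          simp: 3 remainder_cmul remainder_sum[OF _ iint_integrable[OF Uint]] simp del: times_divide_eq_left)
    finally have "\<bar>remainder (iint s k)\<bar> = 1 / N * \<bar>\<Sum>i<J. remainder (iint s (indicat_real (U i)))\<bar>"
      by (simp add: abs_mult)
    also have "\<dots> \<le> 1 / N * (real J * \<epsilon>)"
      using sum_mono[of "{..<J}" "\<lambda>i. \<bar>remainder (iint s (indicat_real (U i)))\<bar>" "\<lambda>_. \<epsilon>"] Ule
      by (intro mult_left_mono order_trans[OF sum_abs]) auto
    also have "\<dots> \<le> 1 / N * (real N * (h 1 - h (-1)) * \<epsilon>)"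
      using J \<epsilon> by (intro mult_left_mono mult_right_mono) auto
    also have "\<dots> = \<epsilon> * (h 1 - h (-1))" using N by simp
    finally show ?thesis using 1 2 by simp
  qed
  have "(\<lambda>N. \<epsilon> * (h 1 - h (-1)) + 4 * 2 ^ s / real N) \<longlonglongrightarrow> \<epsilon> * (h 1 - h (-1)) + 0"
    by (intro tendsto_intros lim_const_over_n)
  moreover have "\<forall>\<^sub>F N in sequentially. \<bar>remainder (iint s h)\<bar> \<le> \<epsilon> * (h 1 - h (-1)) + 4 * 2 ^ s / real N"
    using approx by (intro eventually_sequentiallyI[of 1]) auto
  ultimately show ?thesis by (intro tendsto_lowerbound) auto
qed

lemma remainder_truncated_power:
  assumes "t \<in> {-1..1}" "{t<..1} \<subseteq> U" "U \<subseteq> {t..1}" "degree q < n" "degree M < n"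
    "\<And>x. x \<in> {-1..1} \<Longrightarrow> \<bar>(x - t) ^ s * indicat_real U x - poly q x\<bar> \<le> poly M x"
  shows "\<bar>remainder (\<lambda>x. (x - t) ^ s * indicat_real U x)\<bar> \<le> 2 * integral {-1..1} (poly M)"
proof -
  let ?g = "\<lambda>x. (x - t) ^ s * indicat_real U x"
  have "((\<lambda>x. (x - t) ^ s) integrable_on {t..1})"
    by (intro integrable_continuous_real continuous_intros)
  \<comment> \<open>\<open>U\<close> may omit \<open>t\<close>, so integrability is first shown with
    the closed interval and then transferred across that single point.\<close>
  then have "(\<lambda>x. if x \<in> {t..1} then (x - t) ^ s else 0) integrable_on {-1..1}"
    using assms(1) by (subst integrable_restrict_Int) (simp add: Int_absorb2 Int_commute)
  then have g: "?g integrable_on {-1..1}"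
  proof (rule integrable_spike_finite[of "{t}", rotated 2])
    fix x assume "x \<in> {-1..1} - {t}"
    then show "?g x = (if x \<in> {t..1} then (x - t) ^ s else 0)"
      using assms(2,3) by (cases "x \<in> U") (auto simp: subset_iff)
  qed simp
  have "remainder ?g = remainder (\<lambda>x. ?g x - poly q x)"
    by (simp add: remainder_diff g poly_integrable_on remainder_poly assms)
  also have "\<bar>\<dots>\<bar> \<le> 2 * integral {-1..1} (poly M)"
    using assms by (intro remainder_le integrable_diff g poly_integrable_on) auto
  finally show ?thesis .
qed

end

section \<open>Integral representation of \<open>V s\<close> and the resulting rate\<close>

lemma V_representation:
  assumes "f \<in> V s"
  obtains p h where "degree p \<le> s" "total_variation_on {-1..1} h < \<infinity>"
    "\<And>x. x \<in> {-1..1} \<Longrightarrow> f x = poly p x + iint s h x"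
proof (cases s)
  case 0
  then show ?thesis using that[of 0 f] assms by auto
next
  case (Suc r)
  then obtain g h where gh: "nth_deriv_on {-1..1} r f g" "absolutely_continuous_on {-1..1} g"
    "AE x in lebesgue_on {-1..1}. (g has_real_derivative h x) (at x within {-1..1})"
    "total_variation_on {-1..1} h < \<infinity>" using assms by auto
  have "AE x in lebesgue. x \<in> {-1..1} \<longrightarrow> (g has_real_derivative h x) (at x within {-1..1})"
    using gh(3) by (subst (asm) AE_restrict_space_iff) auto
  then obtain N where N: "N \<in> null_sets lebesgue"
    "{x \<in> space lebesgue. \<not> (x \<in> {-1..1} \<longrightarrow> (g has_real_derivative h x) (at x within {-1..1}))} \<subseteq> N"
    unfolding eventually_ae_filter by blast
  then have neg: "negligible N" by (simp add: negligible_iff_null_sets)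
  \<comment> \<open>Absolute continuity recovers \<open>g\<close> from its almost everywhere
    derivative, which supplies the innermost of the \<open>s\<close> integrations.\<close>
  have ftc: "(h has_integral (g x - g (-1))) {-1..x}" if x: "x \<in> {-1..1}" for x
  proof (rule absolutely_continuous_on_has_integral[OF _ _ neg])
    have "{-1..x} \<subseteq> {-1..1}" using x by auto
    then show "absolutely_continuous_on {-1..x} g"
      using gh(2) unfolding absolutely_continuous_on_def subset_iff by meson
    show "(g has_real_derivative h y) (at y within {-1..x})" if "y \<in> {-1..x} - N" for y
      by (rule has_field_derivative_subset[of _ _ _ "{-1..1}"]) (use that N x in auto)
  qed (use x in simp)
  have hint: "h integrable_on {-1..1}" using ftc[of 1] by (auto intro: has_integral_integrable)
  have g: "g x = g (-1) + integral {-1..x} h" if "x \<in> {-1..1}" for x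
    using ftc[OF that] by (simp add: integral_unique)
  have cont: "continuous_on {-1..1} (\<lambda>x. integral {-1..x} h)"
    by (rule indefinite_integral_continuous_1[OF hint])
  have "continuous_on {-1..1} (\<lambda>x. g (-1) + integral {-1..x} h)"
    by (intro continuous_on_add continuous_on_const cont)
  then have "continuous_on {-1..1} g"
    by (rule continuous_on_eq) (rule g[symmetric])
  then obtain p where p: "degree p \<le> r" "\<And>x. x \<in> {-1..1} \<Longrightarrow> f x = poly p x + iint r g x"
    using nth_deriv_on_iint[OF gh(1)] integrable_continuous_real by blast
  let ?p = "p + smult (g (-1) / fact r) ([:1, 1:] ^ r)"
  show ?thesis
  proof
    show "degree ?p \<le> s"
      using p(1) degree_power_linear_le[of "g (-1) / fact r" 1 r] Suc by (intro degree_add_le) auto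
    show "f x = poly ?p x + iint s h x" if x: "x \<in> {-1..1}" for x
    proof -
      have "iint r g x = iint r (\<lambda>x. g (-1) + integral {-1..x} h) x"
        by (rule iint_cong[OF g x])
      also have "\<dots> = iint r (\<lambda>_. g (-1)) x + iint r (\<lambda>x. integral {-1..x} h) x"
        by (intro iint_add x integrable_continuous_real cont) auto
      finally show ?thesis using p(2)[OF x] x Suc by (simp add: iint_const iint_Suc' add_ac)
    qed
  qed (rule gh(4))
qed

text \<open>The constants are chosen before \<open>n\<close>, \<open>X\<close> and \<open>w\<close>,
  so one bound covers every positive formula exact below degree \<open>n\<close>.\<close>

lemma positive_quadrature_error:
  assumes "f \<in> V s"
  shows "\<exists>C N. \<forall>n X w. n \<ge> N \<longrightarrow> positive_quadrature n X w \<longrightarrow>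
    \<bar>integral {-1..1} f - (\<Sum>y\<in>X. w y * f y)\<bar> \<le> C / real n ^ (s + 1)"
proof -
  obtain p h where ph: "degree p \<le> s" "total_variation_on {-1..1} h < \<infinity>"
    "\<And>x. x \<in> {-1..1} \<Longrightarrow> f x = poly p x + iint s h x"
    using V_representation[OF assms] by blast
  obtain u v where uv: "mono_on {-1..1} u" "mono_on {-1..1} v" "\<And>x. h x = u x - v x"
    using finite_variation_Jordan[OF ph(2)] by blast
  define d where "d = 8 * (s + 2)"
  obtain C :: real where C: "\<And>k t U. t \<in> {-1..1} \<Longrightarrow> {t<..1} \<subseteq> U \<Longrightarrow> U \<subseteq> {t..1} \<Longrightarrow>
    \<exists>q M. degree q \<le> d * (k + 1) \<and> degree M \<le> d * (k + 1) \<and>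
      (\<forall>x\<in>{-1..1}. \<bar>(x - t) ^ s * indicat_real U x - poly q x\<bar> \<le> poly M x) \<and>
      integral {-1..1} (poly M) \<le> C / real (2 * k + 1) ^ (s + 1)"
    using truncated_power_poly_approx[of s] unfolding d_def by metis
  define L where "L = (u 1 - u (-1)) + (v 1 - v (-1))"
  \<comment> \<open>The factor 2 stems from \<open>remainder_truncated_power\<close>, the power of
    \<open>2 * d\<close> from the comparison of \<open>n\<close> with
    \<open>2 * k + 1\<close>.\<close>
  define C' where "C' = 2 * \<bar>C\<bar> * real (2 * d) ^ (s + 1)"
  show ?thesis
  proof (intro exI[of _ "C' * L"] exI[of _ "2 * d"] allI impI)
    fix n X w assume n: "n \<ge> 2 * d" and "positive_quadrature n X w"
    interpret positive_quadrature n X w by fact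
    have d: "d \<ge> 16" by (simp add: d_def)
    have sn: "s < n" using n by (simp add: d_def)
    \<comment> \<open>The largest \<open>k\<close> whose approximants have degree
      \<open>d * (k + 1) < n\<close>; since \<open>n \<ge> 2 * d\<close> the quotient is positive
      and the subtraction of 1 is exact.\<close>
    define k where "k = (n - 1) div d - 1"
    have "(n - 1) div d \<ge> 1" using n d by (simp add: div_greater_zero_iff Suc_le_eq)
    then have k1: "k + 1 = (n - 1) div d" by (simp add: k_def)
    have dk: "d * (k + 1) < n"
      unfolding k1 using n d by (metis One_nat_def div_times_less_eq_dividend less_imp_diff_less mult.commute
          n_pos not_le order_le_less_trans diff_less zero_less_one order_less_le_trans)
    \<comment> \<open>Maximality of \<open>k\<close> bounds \<open>n\<close> by a multiple of
      \<open>2 * k + 1\<close>, turning the rate in \<open>k\<close> into a rate in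
      \<open>n\<close>.\<close>
    have "n - 1 < d * ((n - 1) div d + 1)" using d by (simp add: dividend_less_times_div)
    then have "n \<le> d * (k + 2)" using k1 by simp
    also have "\<dots> \<le> 2 * d * (2 * k + 1)" by (simp add: algebra_simps)
    finally have nk: "real n \<le> real (2 * d) * real (2 * k + 1)"
      by (metis of_nat_le_iff of_nat_mult)
    define \<epsilon> where "\<epsilon> = C' / real n ^ (s + 1)"
    have C'0: "0 \<le> C'" by (simp add: C'_def)
    have \<epsilon>0: "0 \<le> \<epsilon>" using C'0 by (simp add: \<epsilon>_def)
    have step: "\<bar>remainder (\<lambda>x. (x - t) ^ s * indicat_real U x)\<bar> \<le> \<epsilon>"
      if tU: "t \<in> {-1..1}" "{t<..1} \<subseteq> U" "U \<subseteq> {t..1}" for U t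
    proof -
      obtain q M where qM: "degree q \<le> d * (k + 1)" "degree M \<le> d * (k + 1)"
        "\<forall>x\<in>{-1..1}. \<bar>(x - t) ^ s * indicat_real U x - poly q x\<bar> \<le> poly M x"
        "integral {-1..1} (poly M) \<le> C / real (2 * k + 1) ^ (s + 1)"
        using C[OF tU, of k] by blast
      have "\<bar>remainder (\<lambda>x. (x - t) ^ s * indicat_real U x)\<bar> \<le> 2 * integral {-1..1} (poly M)"
        using qM dk by (intro remainder_truncated_power[OF tU]) auto
      also have "\<dots> \<le> 2 * (\<bar>C\<bar> / real (2 * k + 1) ^ (s + 1))"
        using qM(4) by (smt (verit) divide_right_mono zero_le_power of_nat_0_le_iff)
      also have "\<dots> = 2 * \<bar>C\<bar> * (1 / real (2 * k + 1) ^ (s + 1))" by simp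
      also have "\<dots> \<le> 2 * \<bar>C\<bar> * (real (2 * d) ^ (s + 1) / real n ^ (s + 1))"
      proof (rule mult_left_mono)
        have "real n ^ (s + 1) \<le> (real (2 * d) * real (2 * k + 1)) ^ (s + 1)"
          using nk by (intro power_mono) auto
        also have "\<dots> = real (2 * d) ^ (s + 1) * real (2 * k + 1) ^ (s + 1)"
          by (rule power_mult_distrib)
        finally have le: "real n ^ (s + 1) \<le> real (2 * d) ^ (s + 1) * real (2 * k + 1) ^ (s + 1)" .
        have frac: "1 / c \<le> b / a" if "a \<le> b * c" "0 < a" "0 < c" for a b c :: real
          using that by (simp add: field_simps)
        have pos: "0 < real n ^ (s + 1)" "0 < real (2 * k + 1) ^ (s + 1)"
          using n_pos by (auto simp del: power_Suc)
        show "1 / real (2 * k + 1) ^ (s + 1) \<le> real (2 * d) ^ (s + 1) / real n ^ (s + 1)"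
          by (rule frac[OF le pos])
      qed simp
      also have "\<dots> = \<epsilon>" by (simp add: \<epsilon>_def C'_def)
      finally show ?thesis .
    qed
    have ui: "u integrable_on {-1..1}" and vi: "v integrable_on {-1..1}"
      using uv integrable_on_mono_on by auto
    have "remainder f = remainder (\<lambda>x. poly p x + (iint s u x - iint s v x))"
    proof (rule remainder_cong)
      fix x :: real assume x: "x \<in> {-1..1}"
      have "iint s h x = iint s (\<lambda>x. u x - v x) x" by (rule iint_cong[OF uv(3) x])
      then show "f x = poly p x + (iint s u x - iint s v x)"
        using ph(3)[OF x] iint_diff[OF ui vi x] by simp
    qed
    also have "\<dots> = remainder (iint s u) - remainder (iint s v)"
      using ph(1) sn
      by (simp add: remainder_add remainder_diff poly_integrable_on integrable_diff iint_integrable ui vi remainder_poly)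
    finally have "\<bar>remainder f\<bar> \<le> \<bar>remainder (iint s u)\<bar> + \<bar>remainder (iint s v)\<bar>" by simp
    also have "\<dots> \<le> \<epsilon> * (u 1 - u (-1)) + \<epsilon> * (v 1 - v (-1))"
      by (intro add_mono remainder_iint_mono uv sn \<epsilon>0 step)
    also have "\<dots> = C' * L / real n ^ (s + 1)" unfolding \<epsilon>_def L_def by (simp only: distrib_left times_divide_eq_left add_divide_distrib)
    finally show "\<bar>integral {-1..1} f - (\<Sum>y\<in>X. w y * f y)\<bar> \<le> C' * L / real n ^ (s + 1)"
      by (simp add: remainder_def)
  qed
qed

theorem mainTheorem2:
  fixes s :: nat and f :: "real \<Rightarrow> real"
  assumes "f \<in> V s"
  shows "(\<lambda>n. integral {-1..1} f - clenshaw_curtis_quadrature n f) \<in> O(\<lambda>n. 1 / real n ^ (s + 1))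
    \<and> (\<lambda>n. integral {-1..1} f - gauss_quadrature n f) \<in> O(\<lambda>n. 1 / real n ^ (s + 1))"
proof -
  obtain C N where err: "\<forall>n X w. n \<ge> N \<longrightarrow> positive_quadrature n X w \<longrightarrow>
    \<bar>integral {-1..1} f - (\<Sum>y\<in>X. w y * f y)\<bar> \<le> C / real n ^ (s + 1)"
    using positive_quadrature_error[OF assms] by (elim exE)
  \<comment> \<open>Starting at 2 avoids the denominator \<open>n - 1 = 0\<close> in the
    Clenshaw-Curtis nodes.\<close>
  have O: "(\<lambda>n. integral {-1..1} f - Q n f) \<in> O(\<lambda>n. 1 / real n ^ (s + 1))"
    if Q: "\<And>n. n \<ge> 2 \<Longrightarrow> \<exists>X w. positive_quadrature n X w \<and> Q n = (\<lambda>f. \<Sum>y\<in>X. w y * f y)"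
    for Q :: "nat \<Rightarrow> (real \<Rightarrow> real) \<Rightarrow> real"
  proof (rule bigoI, rule eventually_sequentiallyI)
    fix n assume n: "n \<ge> max 2 N"
    then obtain X w where "positive_quadrature n X w" "Q n = (\<lambda>f. \<Sum>y\<in>X. w y * f y)"
      using Q[of n] by auto
    then show "norm (integral {-1..1} f - Q n f) \<le> C * norm (1 / real n ^ (s + 1))"
      using err[rule_format, of n X w] n by simp
  qed
  show ?thesis
    by (intro conjI O clenshaw_curtis_quadrature_positive gauss_quadrature_positive) auto
qed

end
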